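(* The value function $v$ is convex with respect to $c$ and, for some locally bounded functions $\gamma_1,\eta_1:\mathbb R\to\mathbb R$, $$0\le v(c,d)\le\hat V(c,d)\le\gamma_1(c)+\eta_1(c)|d|^\nu,\qquad\forall(c,d)\in\mathcal S.$$
   Context: Setting. $(\Omega,\mathcal F,\mathbb P)$ is a probability space with a filtration $\mathbb F=(\mathcal F_t)_{t\ge 0}$ satisfying the usual conditions and supporting a standard one-dimensional Brownian motion $W$. Let $\mathcal O=(d_{\min},d_{\max})$ with $-\infty\le d_{\min}<d_{\max}\le\infty$ and $\mathcal S=\mathbb R\times\mathcal O$. Demand: $\mathrm dD_t=\mu(D_t)\mathrm dt+\sigma(D_t)\mathrm dW_t$, $D_0=d$, where $\mu,\sigma:\mathcal O\to\mathbb R$ are continuous with at most linear growth; for every $d\in\mathcal O$ there is a unique non-exploding continuous solution $D^d$ with values in $\mathcal O$; if $d_n\to d$ in $\mathcal O$ then $D^{d_n}_t\to D^d_t$ a.s. for every $t$; if $d\le d'$ then $D^d_t\le D^{d'}_t$ a.s. for every $t\ge0$; $D$ is a regular diffusion and $d_{\min},d_{\max}$ are natural boundaries (Feller's classification). Cost: $g:\mathcal S\to[0,\infty)$ is continuous, $g(\cdot,d)\in C^1(\mathbb R)$ is convex for every $d$, the partial derivative $g_c$ is continuous on $\mathcal S$, $g_c(c,\cdot)$ is nonincreasing for every $c$, and $|g(c,d)|+|g_c(c,d)|\le\gamma_0(c)+\eta_0(c)|d|^\nu$ for some positive locally bounded $\gamma_0,\eta_0$ and some $\nu\ge0$. $K_0\ge0,K_1\in\mathbb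 R$ are constants such that $\mathbb E|D^d_t|^\nu\le K_0(1+|d|^\nu)e^{K_1t}$ for all $t,d$ (they exist by linear growth), and $\rho>\max(K_1,0)$. The constants $q_0^+,q_0^-$ are in $(0,\infty)$. Controls: $\mathcal I$ is the set of càdlàg $\mathbb F$-adapted processes $I$ of bounded variation on bounded time intervals, with $I_{0^-}=0$; $I=I^+-I^-$ is the minimal decomposition ($I^\pm$ the positive/negative variations). Capacity: $C^{c,I}_t=c+I_t$. Define $$G(c,d;I)=\mathbb E\Big[\int_0^\infty e^{-\rho t}\big(g(C^{c,I}_t,D^d_t)\mathrm dt+q_0^+\mathrm dI^+_t+q_0^-\mathrm dI^-_t\big)\Big]$$ (a jump at time $0$ is counted), $v(c,d)=\inf_{I\in\mathcal I}G(c,d;I)$, and $\hat V(c,d)=\mathbb E[\int_0^\infty e^{-\rho t}g(c,D^d_t)\mathrm dt]$. *)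

theory Defs
  imports "HOL-Probability.Probability"
begin

text \<open>Time is the half-line \<open>t \<ge> 0\<close> inside \<^typ>\<open>real\<close>; filtrations and processes are only
  constrained there, except for controls (see below).\<close>

section \<open>Filtrations and Brownian motion\<close>

definition usual_filtration :: "'a measure \<Rightarrow> (real \<Rightarrow> 'a measure) \<Rightarrow> bool" where
  "usual_filtration M F \<longleftrightarrow>
     (\<forall>t\<ge>0. space (F t) = space M \<and> sets (F t) \<subseteq> sets M) \<and>
     (\<forall>s\<ge>0. \<forall>t\<ge>s. sets (F s) \<subseteq> sets (F t)) \<and>
     (\<forall>t\<ge>0. sets (F t) = (\<Inter>s\<in>{t<..}. sets (F s))) \<and>
     (\<forall>N\<in>null_sets M. \<forall>A\<subseteq>N. A \<in> sets (F 0))"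

definition adapted :: "(real \<Rightarrow> 'a measure) \<Rightarrow> (real \<Rightarrow> 'a \<Rightarrow> real) \<Rightarrow> bool" where
  "adapted F X \<longleftrightarrow> (\<forall>t\<ge>0. X t \<in> borel_measurable (F t))"

definition progressive :: "(real \<Rightarrow> 'a measure) \<Rightarrow> (real \<Rightarrow> 'a \<Rightarrow> real) \<Rightarrow> bool" where
  "progressive F X \<longleftrightarrow>
     (\<forall>T\<ge>0. (\<lambda>(t, \<omega>). X t \<omega>) \<in> borel_measurable (restrict_space borel {0..T} \<Otimes>\<^sub>M F T))"

definition brownian_motion ::
    "'a measure \<Rightarrow> (real \<Rightarrow> 'a measure) \<Rightarrow> (real \<Rightarrow> 'a \<Rightarrow> real) \<Rightarrow> bool" where
  "brownian_motion M F W \<longleftrightarrow>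
     adapted F W \<and>
     (AE \<omega> in M. W 0 \<omega> = 0) \<and>
     (AE \<omega> in M. continuous_on {0..} (\<lambda>t. W t \<omega>)) \<and>
     (\<forall>s\<ge>0. \<forall>t>s.
        distributed M lborel (\<lambda>\<omega>. W t \<omega> - W s \<omega>)
          (\<lambda>x. ennreal (normal_density 0 (sqrt (t - s)) x)) \<and>
        prob_space.indep_set M (sets (F s))
          (sets (vimage_algebra (space M) (\<lambda>\<omega>. W t \<omega> - W s \<omega>) borel)))"

section \<open>The Ito integral\<close>

text \<open>The triple \<open>n\<close>, \<open>\<tau>\<close>, \<open>\<xi>\<close> stands for the simple process
  \<open>\<Sum>i<n. \<xi> i * indicator {\<tau> i<..\<tau> (Suc i)}\<close>.\<close>

definition simple_integrand ::
    "'a measure \<Rightarrow> (real \<Rightarrow> 'a measure) \<Rightarrow> nat \<Rightarrow> (nat \<Rightarrow> real) \<Rightarrow> (nat \<Rightarrow> 'a \<Rightarrow> real) \<Rightarrow> bool" where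
  "simple_integrand M F n \<tau> \<xi> \<longleftrightarrow>
     0 \<le> \<tau> 0 \<and> (\<forall>i<n. \<tau> i \<le> \<tau> (Suc i)) \<and>
     (\<forall>i<n. \<xi> i \<in> borel_measurable (F (\<tau> i)) \<and> bounded (\<xi> i ` space M))"

definition simple_process ::
    "nat \<Rightarrow> (nat \<Rightarrow> real) \<Rightarrow> (nat \<Rightarrow> 'a \<Rightarrow> real) \<Rightarrow> real \<Rightarrow> 'a \<Rightarrow> real" where
  "simple_process n \<tau> \<xi> t \<omega> = (\<Sum>i<n. \<xi> i \<omega> * indicator {\<tau> i<..\<tau> (Suc i)} t)"

definition simple_ito_integral ::
    "(real \<Rightarrow> 'a \<Rightarrow> real) \<Rightarrow> nat \<Rightarrow> (nat \<Rightarrow> real) \<Rightarrow> (nat \<Rightarrow> 'a \<Rightarrow> real) \<Rightarrow> real \<Rightarrow> 'a \<Rightarrow> real" where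
  "simple_ito_integral W n \<tau> \<xi> t \<omega> =
     (\<Sum>i<n. \<xi> i \<omega> * (W (min t (\<tau> (Suc i))) \<omega> - W (min t (\<tau> i)) \<omega>))"

text \<open>\<open>Y\<close> is (a version of) the continuous process \<open>\<integral>\<^sub>0\<^sup>t H dW\<close>: the limit in probability of
  integrals of simple processes approximating \<open>H\<close> in \<open>L\<^sup>2([0,T])\<close> in probability, for every \<open>T\<close>.
  The localised integrand class is used: \<open>H\<close> progressive with almost surely locally
  square-integrable paths.\<close>

definition ito_integral ::
    "'a measure \<Rightarrow> (real \<Rightarrow> 'a measure) \<Rightarrow> (real \<Rightarrow> 'a \<Rightarrow> real) \<Rightarrow>
     (real \<Rightarrow> 'a \<Rightarrow> real) \<Rightarrow> (real \<Rightarrow> 'a \<Rightarrow> real) \<Rightarrow> bool" where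
  "ito_integral M F W H Y \<longleftrightarrow>
     progressive F H \<and>
     (AE \<omega> in M. \<forall>T\<ge>0. (\<integral>\<^sup>+s\<in>{0..T}. ennreal ((H s \<omega>)\<^sup>2) \<partial>lborel) < \<infinity>) \<and>
     adapted F Y \<and> (AE \<omega> in M. continuous_on {0..} (\<lambda>t. Y t \<omega>)) \<and>
     (\<exists>n \<tau> \<xi>. (\<forall>k. simple_integrand M F (n k) (\<tau> k) (\<xi> k)) \<and>
        (\<forall>T\<ge>0. \<forall>\<epsilon>>0.
           (\<lambda>k. measure M {\<omega> \<in> space M.
              (\<integral>\<^sup>+s\<in>{0..T}. ennreal ((simple_process (n k) (\<tau> k) (\<xi> k) s \<omega> - H s \<omega>)\<^sup>2) \<partial>lborel)
                > ennreal \<epsilon>}) \<longlonglongrightarrow> 0) \<and>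
        (\<forall>t\<ge>0. \<forall>\<epsilon>>0.
           (\<lambda>k. measure M {\<omega> \<in> space M.
              \<bar>simple_ito_integral W (n k) (\<tau> k) (\<xi> k) t \<omega> - Y t \<omega>\<bar> > \<epsilon>}) \<longlonglongrightarrow> 0))"

section \<open>The demand diffusion\<close>

definition open_interval :: "ereal \<Rightarrow> ereal \<Rightarrow> real set" where
  "open_interval a b = {x. a < ereal x \<and> ereal x < b}"

text \<open>Being a global process with values in the interval \<open>J\<close>, a solution does not explode.\<close>

definition sde_solution ::
    "'a measure \<Rightarrow> (real \<Rightarrow> 'a measure) \<Rightarrow> (real \<Rightarrow> 'a \<Rightarrow> real) \<Rightarrow> real set \<Rightarrow>
     (real \<Rightarrow> real) \<Rightarrow> (real \<Rightarrow> real) \<Rightarrow> real \<Rightarrow> (real \<Rightarrow> 'a \<Rightarrow> real) \<Rightarrow> bool" where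
  "sde_solution M F W J \<mu> \<sigma> x X \<longleftrightarrow>
     adapted F X \<and>
     (\<forall>\<omega>\<in>space M. continuous_on {0..} (\<lambda>t. X t \<omega>) \<and> (\<forall>t\<ge>0. X t \<omega> \<in> J)) \<and>
     (\<exists>Y. ito_integral M F W (\<lambda>t \<omega>. \<sigma> (X t \<omega>)) Y \<and>
        (AE \<omega> in M. \<forall>t\<ge>0. X t \<omega> = x + integral {0..t} (\<lambda>s. \<mu> (X s \<omega>)) + Y t \<omega>))"

definition unique_sde_solution ::
    "'a measure \<Rightarrow> (real \<Rightarrow> 'a measure) \<Rightarrow> (real \<Rightarrow> 'a \<Rightarrow> real) \<Rightarrow> real set \<Rightarrow>
     (real \<Rightarrow> real) \<Rightarrow> (real \<Rightarrow> real) \<Rightarrow> real \<Rightarrow> (real \<Rightarrow> 'a \<Rightarrow> real) \<Rightarrow> bool" where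
  "unique_sde_solution M F W J \<mu> \<sigma> x X \<longleftrightarrow>
     sde_solution M F W J \<mu> \<sigma> x X \<and>
     (\<forall>X'. sde_solution M F W J \<mu> \<sigma> x X' \<longrightarrow> (AE \<omega> in M. \<forall>t\<ge>0. X' t \<omega> = X t \<omega>))"

text \<open>Regularity of a one-dimensional diffusion: every point of the interval is reached with positive
  probability from every other one.\<close>

definition regular_diffusion ::
    "'a measure \<Rightarrow> real set \<Rightarrow> (real \<Rightarrow> real \<Rightarrow> 'a \<Rightarrow> real) \<Rightarrow> bool" where
  "regular_diffusion M J D \<longleftrightarrow>
     (\<forall>x\<in>J. \<forall>y\<in>J. measure M {\<omega> \<in> space M. \<exists>t\<ge>0. D x t \<omega> = y} > 0)"

text \<open>Feller's classification in terms of the scale and speed densities (based at \<open>x\<^sub>0\<close>):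
  a boundary is natural iff both of Feller's integrals diverge there, i.e. it is neither regular,
  nor exit, nor entrance. The choice of \<open>x\<^sub>0\<close> is immaterial.\<close>

definition scale_density :: "(real \<Rightarrow> real) \<Rightarrow> (real \<Rightarrow> real) \<Rightarrow> real \<Rightarrow> real \<Rightarrow> real" where
  "scale_density \<mu> \<sigma> x\<^sub>0 x = exp (- (LBINT z=ereal x\<^sub>0..ereal x. 2 * \<mu> z / (\<sigma> z)\<^sup>2))"

definition speed_density :: "(real \<Rightarrow> real) \<Rightarrow> (real \<Rightarrow> real) \<Rightarrow> real \<Rightarrow> real \<Rightarrow> real" where
  "speed_density \<mu> \<sigma> x\<^sub>0 x = 2 / ((\<sigma> x)\<^sup>2 * scale_density \<mu> \<sigma> x\<^sub>0 x)"

definition natural_upper_boundary :: "real set \<Rightarrow> (real \<Rightarrow> real) \<Rightarrow> (real \<Rightarrow> real) \<Rightarrow> bool" where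
  "natural_upper_boundary J \<mu> \<sigma> \<longleftrightarrow> (\<forall>x\<^sub>0\<in>J.
     (\<integral>\<^sup>+x\<in>{x\<in>J. x\<^sub>0 \<le> x}. (\<integral>\<^sup>+y\<in>{x\<^sub>0..x}. ennreal (speed_density \<mu> \<sigma> x\<^sub>0 y) \<partial>lborel)
        * ennreal (scale_density \<mu> \<sigma> x\<^sub>0 x) \<partial>lborel) = \<infinity> \<and>
     (\<integral>\<^sup>+x\<in>{x\<in>J. x\<^sub>0 \<le> x}. (\<integral>\<^sup>+y\<in>{x\<^sub>0..x}. ennreal (scale_density \<mu> \<sigma> x\<^sub>0 y) \<partial>lborel)
        * ennreal (speed_density \<mu> \<sigma> x\<^sub>0 x) \<partial>lborel) = \<infinity>)"

definition natural_lower_boundary :: "real set \<Rightarrow> (real \<Rightarrow> real) \<Rightarrow> (real \<Rightarrow> real) \<Rightarrow> bool" where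
  "natural_lower_boundary J \<mu> \<sigma> \<longleftrightarrow> (\<forall>x\<^sub>0\<in>J.
     (\<integral>\<^sup>+x\<in>{x\<in>J. x \<le> x\<^sub>0}. (\<integral>\<^sup>+y\<in>{x..x\<^sub>0}. ennreal (speed_density \<mu> \<sigma> x\<^sub>0 y) \<partial>lborel)
        * ennreal (scale_density \<mu> \<sigma> x\<^sub>0 x) \<partial>lborel) = \<infinity> \<and>
     (\<integral>\<^sup>+x\<in>{x\<in>J. x \<le> x\<^sub>0}. (\<integral>\<^sup>+y\<in>{x..x\<^sub>0}. ennreal (scale_density \<mu> \<sigma> x\<^sub>0 y) \<partial>lborel)
        * ennreal (speed_density \<mu> \<sigma> x\<^sub>0 x) \<partial>lborel) = \<infinity>)"

section \<open>Controls, costs and the value function\<close>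

text \<open>Unlike \<^term>\<open>\<bar>x\<bar> powr \<nu>\<close>, this has the value 1 at \<open>x = 0\<close>, \<open>\<nu> = 0\<close>.\<close>

definition abs_pow :: "real \<Rightarrow> real \<Rightarrow> real" where
  "abs_pow x \<nu> = (if \<nu> = 0 then 1 else \<bar>x\<bar> powr \<nu>)"

definition locally_bounded :: "(real \<Rightarrow> real) \<Rightarrow> bool" where
  "locally_bounded f \<longleftrightarrow> (\<forall>x. \<exists>U. open U \<and> x \<in> U \<and> bounded (f ` U))"

definition cadlag :: "(real \<Rightarrow> real) \<Rightarrow> bool" where
  "cadlag f \<longleftrightarrow> (\<forall>t. (f \<longlongrightarrow> f t) (at_right t) \<and> (\<exists>l. (f \<longlongrightarrow> l) (at_left t)))"

definition variation_sums :: "(real \<Rightarrow> real) \<Rightarrow> (real \<Rightarrow> real) \<Rightarrow> real set \<Rightarrow> real set" where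
  "variation_sums \<phi> f S =
     {\<Sum>i<n. \<phi> (f (x (Suc i)) - f (x i)) | n x. (\<forall>i\<le>n. x i \<in> S) \<and> (\<forall>i<n. x i \<le> x (Suc i))}"

text \<open>Paths of controls are extended by 0 to negative times; this encodes \<open>I\<^bsub>0-\<^esub> = 0\<close>, and makes the
  variations over \<open>{..t}\<close> and their Stieltjes measures account for a jump at time 0.\<close>

definition pos_variation :: "(real \<Rightarrow> real) \<Rightarrow> real \<Rightarrow> real" where
  "pos_variation f t = Sup (variation_sums (\<lambda>y. max y 0) f {..t})"

definition neg_variation :: "(real \<Rightarrow> real) \<Rightarrow> real \<Rightarrow> real" where
  "neg_variation f t = Sup (variation_sums (\<lambda>y. max (- y) 0) f {..t})"

definition controls :: "'a measure \<Rightarrow> (real \<Rightarrow> 'a measure) \<Rightarrow> (real \<Rightarrow> 'a \<Rightarrow> real) set" where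
  "controls M F = {I. adapted F I \<and>
     (\<forall>\<omega>\<in>space M. (\<forall>t<0. I t \<omega> = 0) \<and> cadlag (\<lambda>t. I t \<omega>) \<and>
        (\<forall>T\<ge>0. bdd_above (variation_sums abs (\<lambda>t. I t \<omega>) {0..T})))}"

text \<open>All integrands below are nonnegative, so expectations are taken in \<open>[0,\<infinity>]\<close>.\<close>

definition total_cost ::
    "'a measure \<Rightarrow> (real \<Rightarrow> real \<Rightarrow> 'a \<Rightarrow> real) \<Rightarrow> (real \<Rightarrow> real \<Rightarrow> real) \<Rightarrow> real \<Rightarrow> real \<Rightarrow> real \<Rightarrow>
     real \<Rightarrow> real \<Rightarrow> (real \<Rightarrow> 'a \<Rightarrow> real) \<Rightarrow> ereal" where
  "total_cost M D g \<rho> qp qm c d I = enn2ereal (\<integral>\<^sup>+\<omega>.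
     ((\<integral>\<^sup>+t\<in>{0..}. ennreal (exp (- \<rho> * t) * g (c + I t \<omega>) (D d t \<omega>)) \<partial>lborel)
      + ennreal qp * (\<integral>\<^sup>+t\<in>{0..}. ennreal (exp (- \<rho> * t))
          \<partial>interval_measure (pos_variation (\<lambda>s. I s \<omega>)))
      + ennreal qm * (\<integral>\<^sup>+t\<in>{0..}. ennreal (exp (- \<rho> * t))
          \<partial>interval_measure (neg_variation (\<lambda>s. I s \<omega>)))) \<partial>M)"

definition value_function ::
    "'a measure \<Rightarrow> (real \<Rightarrow> 'a measure) \<Rightarrow> (real \<Rightarrow> real \<Rightarrow> 'a \<Rightarrow> real) \<Rightarrow> (real \<Rightarrow> real \<Rightarrow> real) \<Rightarrow>
     real \<Rightarrow> real \<Rightarrow> real \<Rightarrow> real \<Rightarrow> real \<Rightarrow> ereal" where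
  "value_function M F D g \<rho> qp qm c d = (INF I\<in>controls M F. total_cost M D g \<rho> qp qm c d I)"

definition uncontrolled_cost ::
    "'a measure \<Rightarrow> (real \<Rightarrow> real \<Rightarrow> 'a \<Rightarrow> real) \<Rightarrow> (real \<Rightarrow> real \<Rightarrow> real) \<Rightarrow> real \<Rightarrow>
     real \<Rightarrow> real \<Rightarrow> ereal" where
  "uncontrolled_cost M D g \<rho> c d = enn2ereal (\<integral>\<^sup>+\<omega>.
     (\<integral>\<^sup>+t\<in>{0..}. ennreal (exp (- \<rho> * t) * g c (D d t \<omega>)) \<partial>lborel) \<partial>M)"

end

theory Submission
  imports Defs
begin

text \<open>A convex combination of controls is a control, and the cost of the combination is at most the
  combination of the costs: for the running cost this is convexity of \<open>g\<close>, for the control cost it is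
  sublinearity of the positive variation, transported to Stieltjes integrals by
  \<open>\<integral>\<^sub>[\<^sub>0\<^sub>,\<^sub>\<infinity>\<^sub>) exp (- \<rho> * t) dP\<^sub>t = \<integral>\<^sub>0\<^sup>\<infinity> \<rho> * exp (- \<rho> * s) * P\<^sub>s ds\<close>. Because the
  nonnegative integral is only superadditive on nonmeasurable functions, taking expectations requires
  the costs to be measurable in \<open>\<omega>\<close>; right continuity of paths reduces this to countably many times.
  The upper bounds come from the null control, Tonelli's theorem and the moment estimate.\<close>

section \<open>Positive variation of a path\<close>

text \<open>The obstacle is the positive variation as a function of \<open>\<omega>\<close>: it is a
  supremum over uncountably many partitions. Restricting partitions to rational points is harmless
  only if the variation is itself right continuous, and this has to be derived from right continuity
  of the path. Minimality of the variation among nonnegative functions with dominating increments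
  yields this, and also sublinearity and the rational formula. The negative variation needs no
  theory of its own, being the positive variation of \<open>- f\<close>. The two claims are not
  independent: \<open>real_of_ereal\<close> would turn an infinite value into 0, so convexity of the
  real-valued function is obtained only after the growth bound has shown the value to be
  finite.\<close>

text \<open>\<open>S\<close> is the set of admissible partition points: \<open>UNIV\<close> gives
  the usual variation, \<open>\<rat>\<close> a supremum over countably many sums.\<close>

definition pos_var_on :: "real set \<Rightarrow> (real \<Rightarrow> real) \<Rightarrow> real \<Rightarrow> real" where
  "pos_var_on S f t = Sup (variation_sums (\<lambda>y. max y 0) f (S \<inter> {..t}))"

text \<open>The pathwise half of \<open>controls\<close>, so that the variation can be studied for
  one deterministic function.\<close>

definition control_path :: "(real \<Rightarrow> real) \<Rightarrow> bool" where
  "control_path f \<longleftrightarrow> (\<forall>t<0. f t = 0) \<and> cadlag f \<and>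
     (\<forall>T\<ge>0. bdd_above (variation_sums abs f {0..T}))"

lemma pos_variation_eq_pos_var_on: "pos_variation f t = pos_var_on UNIV f t"
  by (simp add: pos_variation_def pos_var_on_def)

lemma neg_variation_eq_pos_variation: "neg_variation f t = pos_variation (\<lambda>s. - f s) t"
proof -
  have "variation_sums (\<lambda>y. max (- y) 0) f {..t} = variation_sums (\<lambda>y. max y 0) (\<lambda>s. - f s) {..t}"
    unfolding variation_sums_def by (simp add: minus_diff_eq)
  then show ?thesis by (simp add: neg_variation_def pos_variation_def)
qed

lemma variation_sums_mono: "S \<subseteq> T \<Longrightarrow> variation_sums \<phi> f S \<subseteq> variation_sums \<phi> f T"
  unfolding variation_sums_def by blast

lemma variation_sums_nonempty:
  assumes "t \<in> S" shows "variation_sums \<phi> f S \<noteq> {}"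
proof -
  have "(\<Sum>i<0. \<phi> (f ((\<lambda>_. t) (Suc i)) - f ((\<lambda>_. t) i))) \<in> variation_sums \<phi> f S"
    unfolding variation_sums_def using assms by (intro CollectI exI[of _ 0] exI[of _ "\<lambda>_. t"]) simp
  then show ?thesis by blast
qed

text \<open>Bounded variation is assumed on \<open>{0..T}\<close>, while these partitions may start
  at negative times. Moving negative points to 0 changes only the single step that crosses 0, since
  \<open>f\<close> vanishes before; its cost is at most \<open>\<bar>f 0\<bar>\<close> extra, the
  possible jump at time 0. The induction therefore grants \<open>\<bar>f 0\<bar>\<close> once the
  crossing has happened.\<close>

lemma bdd_above_pos_variation_sums:
  assumes "control_path f"
  shows "bdd_above (variation_sums (\<lambda>y. max y 0) f {..t})"
proof -
  define T where "T = max t 0"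
  obtain B where B: "\<And>s. s \<in> variation_sums abs f {0..T} \<Longrightarrow> s \<le> B"
    using assms unfolding control_path_def bdd_above_def T_def
    by (meson max.cobounded2)
  have z: "f s = 0" if "s < 0" for s using assms that by (simp add: control_path_def)
  show ?thesis
  proof (rule bdd_aboveI[of _ "\<bar>f 0\<bar> + B"])
    fix s assume "s \<in> variation_sums (\<lambda>y. max y 0) f {..t}"
    then obtain n x where s: "s = (\<Sum>i<n. max (f (x (Suc i)) - f (x i)) 0)"
      and x: "\<forall>i\<le>n. x i \<le> t" "\<forall>i<n. x i \<le> x (Suc i)"
      by (auto simp: variation_sums_def)
    define y where "y i = max (x i) 0" for i
    have *: "(\<Sum>i<m. max (f (x (Suc i)) - f (x i)) 0)
            \<le> (if x m < 0 then 0 else \<bar>f 0\<bar>) + (\<Sum>i<m. \<bar>f (y (Suc i)) - f (y i)\<bar>)" if "m \<le> n" for m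
      using that
    proof (induction m)
      case (Suc m)
      have le: "x m \<le> x (Suc m)" using Suc.prems x(2) by simp
      consider "x (Suc m) < 0" | "x m < 0" "x (Suc m) \<ge> 0" | "x m \<ge> 0" "x (Suc m) \<ge> 0"
        using le by linarith
      then have "(if x m < 0 then 0 else \<bar>f 0\<bar>) + max (f (x (Suc m)) - f (x m)) 0
          \<le> (if x (Suc m) < 0 then 0 else \<bar>f 0\<bar>) + \<bar>f (y (Suc m)) - f (y m)\<bar>"
      proof cases
        case 1
        then have "y (Suc m) = 0" "y m = 0" "x m < 0" using le by (auto simp: y_def)
        with 1 show ?thesis by (simp add: z)
      next
        case 2
        then have "y (Suc m) = x (Suc m)" "y m = 0" by (auto simp: y_def)
        with 2 show ?thesis by (auto simp: z)
      next
        case 3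
        then have "y (Suc m) = x (Suc m)" "y m = x m" by (auto simp: y_def)
        with 3 show ?thesis by auto
      qed
      with Suc show ?case by simp
    qed simp
    have "\<forall>i\<le>n. y i \<in> {0..T}" using x(1) unfolding y_def T_def by fastforce
    moreover have "\<forall>i<n. y i \<le> y (Suc i)" using x(2) unfolding y_def by fastforce
    ultimately have "(\<Sum>i<n. \<bar>f (y (Suc i)) - f (y i)\<bar>) \<in> variation_sums abs f {0..T}"
      unfolding variation_sums_def by blast
    from B[OF this] *[OF order_refl] show "s \<le> \<bar>f 0\<bar> + B"
      unfolding s by (simp split: if_splits)
  qed
qed

lemma bdd_above_pos_variation_sums_on:
  assumes "control_path f"
  shows "bdd_above (variation_sums (\<lambda>y. max y 0) f (S \<inter> {..t}))"
  by (rule bdd_above_mono[OF bdd_above_pos_variation_sums[OF assms, of t]]) (simp add: variation_sums_mono)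

section \<open>Increments and minimality of the positive variation\<close>

lemma pos_var_on_increment:
  assumes f: "control_path f" and "s \<in> S" "t \<in> S" "s \<le> t"
  shows "pos_var_on S f s + max (f t - f s) 0 \<le> pos_var_on S f t"
proof -
  have "pos_var_on S f s \<le> pos_var_on S f t - max (f t - f s) 0"
    unfolding pos_var_on_def[of S f s]
  proof (rule cSup_least)
    show "variation_sums (\<lambda>y. max y 0) f (S \<inter> {..s}) \<noteq> {}"
      using \<open>s \<in> S\<close> by (intro variation_sums_nonempty[of s]) simp
    fix r assume "r \<in> variation_sums (\<lambda>y. max y 0) f (S \<inter> {..s})"
    then obtain n x where r: "r = (\<Sum>i<n. max (f (x (Suc i)) - f (x i)) 0)"
      and x: "\<forall>i\<le>n. x i \<in> S \<inter> {..s}" "\<forall>i<n. x i \<le> x (Suc i)"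
      by (auto simp: variation_sums_def)
    \<comment> \<open>Any partition up to \<open>s\<close> is prolonged by \<open>s\<close> and then
      \<open>t\<close>. Inserting \<open>s\<close> makes the last step exactly
      \<open>f t - f s\<close>; the step into \<open>s\<close> is nonnegative and is
      dropped.\<close>
    define y where "y i = (if i \<le> n then x i else if i = Suc n then s else t)" for i
    have "(\<Sum>i<Suc (Suc n). max (f (y (Suc i)) - f (y i)) 0) \<in> variation_sums (\<lambda>y. max y 0) f (S \<inter> {..t})"
      unfolding variation_sums_def using x assms
      by (intro CollectI exI[of _ "Suc (Suc n)"] exI[of _ y])
         (auto simp: y_def less_Suc_eq le_Suc_eq intro: order_trans)
    then have "(\<Sum>i<Suc (Suc n). max (f (y (Suc i)) - f (y i)) 0) \<le> pos_var_on S f t"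
      unfolding pos_var_on_def by (intro cSup_upper bdd_above_pos_variation_sums_on f)
    moreover have "(\<Sum>i<n. max (f (y (Suc i)) - f (y i)) 0) = r"
      unfolding r by (intro sum.cong) (auto simp: y_def)
    moreover have "y (Suc n) = s" "y (Suc (Suc n)) = t" by (auto simp: y_def)
    ultimately have "r + max (f s - f (y n)) 0 + max (f t - f s) 0 \<le> pos_var_on S f t"
      by simp
    then show "r \<le> pos_var_on S f t - max (f t - f s) 0"
      using max.cobounded2[of 0 "f s - f (y n)"] by linarith
  qed
  then show ?thesis by simp
qed

lemma pos_var_on_nonneg:
  assumes "control_path f" "t \<in> S" shows "0 \<le> pos_var_on S f t"
proof -
  have "(\<Sum>i<0. max (f ((\<lambda>_. t) (Suc i)) - f ((\<lambda>_. t) i)) 0) \<in> variation_sums (\<lambda>y. max y 0) f (S \<inter> {..t})"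
    unfolding variation_sums_def using assms by (intro CollectI exI[of _ 0] exI[of _ "\<lambda>_. t"]) simp
  then show ?thesis
    unfolding pos_var_on_def using bdd_above_pos_variation_sums_on[OF assms(1), of S t]
    by (metis (no_types, lifting) cSup_upper lessThan_0 sum.empty)
qed

text \<open>Together with \<open>pos_var_on_increment\<close> this characterises the positive variation as the least
  nonnegative function whose increments dominate those of \<open>f\<close>; every comparison below is obtained
  by exhibiting such a function.\<close>

lemma pos_var_on_least:
  assumes "t \<in> S" and nonneg: "\<And>u. u \<in> S \<Longrightarrow> u \<le> t \<Longrightarrow> 0 \<le> h u"
    and incr: "\<And>u v. u \<in> S \<Longrightarrow> v \<in> S \<Longrightarrow> u \<le> v \<Longrightarrow> v \<le> t \<Longrightarrow> max (f v - f u) 0 \<le> h v - h u"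
  shows "pos_var_on S f t \<le> h t"
  unfolding pos_var_on_def
proof (rule cSup_least)
  show "variation_sums (\<lambda>y. max y 0) f (S \<inter> {..t}) \<noteq> {}"
    using \<open>t \<in> S\<close> by (intro variation_sums_nonempty[of t]) simp
  fix r assume "r \<in> variation_sums (\<lambda>y. max y 0) f (S \<inter> {..t})"
  then obtain n x where r: "r = (\<Sum>i<n. max (f (x (Suc i)) - f (x i)) 0)"
    and x: "\<forall>i\<le>n. x i \<in> S \<inter> {..t}" "\<forall>i<n. x i \<le> x (Suc i)"
    by (auto simp: variation_sums_def)
  have "r \<le> (\<Sum>i<n. h (x (Suc i)) - h (x i))"
    unfolding r using x by (intro sum_mono incr) auto
  also have "\<dots> = h (x n) - h (x 0)"
    by (rule sum_lessThan_telescope)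
  also have "\<dots> \<le> h (x n)" using nonneg[of "x 0"] x by auto
  also have "\<dots> \<le> h t" using incr[of "x n" t] x \<open>t \<in> S\<close> by fastforce
  finally show "r \<le> h t" .
qed

lemma pos_variation_increment:
  "control_path f \<Longrightarrow> s \<le> t \<Longrightarrow> pos_variation f s + max (f t - f s) 0 \<le> pos_variation f t"
  unfolding pos_variation_eq_pos_var_on by (rule pos_var_on_increment) auto

lemma pos_variation_nonneg: "control_path f \<Longrightarrow> 0 \<le> pos_variation f t"
  unfolding pos_variation_eq_pos_var_on by (rule pos_var_on_nonneg) auto

lemma pos_variation_mono: "control_path f \<Longrightarrow> s \<le> t \<Longrightarrow> pos_variation f s \<le> pos_variation f t"
  using pos_variation_increment[of f s t] by simp

lemma pos_variation_least:
  assumes "\<And>u. u \<le> t \<Longrightarrow> 0 \<le> h u"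
    and "\<And>u v. u \<le> v \<Longrightarrow> v \<le> t \<Longrightarrow> max (f v - f u) 0 \<le> h v - h u"
  shows "pos_variation f t \<le> h t"
  unfolding pos_variation_eq_pos_var_on by (rule pos_var_on_least) (simp_all add: assms del: max.bounded_iff)

lemma pos_variation_neg_time:
  assumes "control_path f" "t < 0" shows "pos_variation f t = 0"
proof (rule antisym)
  have "f u = 0" if "u \<le> t" for u using that assms by (simp add: control_path_def)
  then show "pos_variation f t \<le> 0"
    by (intro pos_variation_least[where h="\<lambda>_. 0"]) simp_all
qed (rule pos_variation_nonneg[OF assms(1)])

section \<open>Sublinearity and right continuity of the positive variation\<close>

lemma pos_variation_combination:
  assumes f: "control_path f" and g: "control_path g" and ab: "0 \<le> a" "0 \<le> b"
  shows "pos_variation (\<lambda>s. a * f s + b * g s) t \<le> a * pos_variation f t + b * pos_variation g t"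
proof (rule pos_variation_least[where h="\<lambda>t. a * pos_variation f t + b * pos_variation g t"])
  fix u :: real
  show "0 \<le> a * pos_variation f u + b * pos_variation g u"
    by (intro add_nonneg_nonneg mult_nonneg_nonneg ab pos_variation_nonneg f g)
next
  fix u v :: real assume "u \<le> v"
  then have "max (f v - f u) 0 \<le> pos_variation f v - pos_variation f u"
    "max (g v - g u) 0 \<le> pos_variation g v - pos_variation g u"
    using pos_variation_increment[OF f, of u v] pos_variation_increment[OF g, of u v] by linarith+
  then have "a * max (f v - f u) 0 \<le> a * (pos_variation f v - pos_variation f u)"
    "b * max (g v - g u) 0 \<le> b * (pos_variation g v - pos_variation g u)"
    using ab by (intro mult_left_mono; simp)+
  moreover have "a * (f v - f u) \<le> a * max (f v - f u) 0" "b * (g v - g u) \<le> b * max (g v - g u) 0"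
    "0 \<le> a * max (f v - f u) 0" "0 \<le> b * max (g v - g u) 0"
    using ab by (simp_all add: mult_left_mono)
  ultimately show "max (a * f v + b * g v - (a * f u + b * g u)) 0
      \<le> a * pos_variation f v + b * pos_variation g v - (a * pos_variation f u + b * pos_variation g u)"
    unfolding right_diff_distrib by linarith
qed

text \<open>Used three times: for the rational formula, for \<open>interval_measure\<close>, whose
  evaluation requires a right-continuous function, and for joint measurability in time and
  \<open>\<omega>\<close>. In the proof \<open>L\<close> is the right limit at
  \<open>t\<close>.\<close>

lemma pos_variation_right_continuous:
  assumes f: "control_path f"
  shows "(pos_variation f \<longlongrightarrow> pos_variation f t) (at_right t)"
proof -
  define L where "L = (INF u\<in>{t<..}. pos_variation f u)"
  have bdd: "bdd_below (pos_variation f ` {t<..})"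
    using pos_variation_nonneg[OF f] by (intro bdd_belowI2[of _ 0])
  have rc: "(f \<longlongrightarrow> f t) (at_right t)"
    using f by (simp add: control_path_def cadlag_def)
  have L_le: "L \<le> pos_variation f u" if "t < u" for u
    unfolding L_def using that by (intro cINF_lower bdd) auto
  have L_ge: "pos_variation f t \<le> L"
    unfolding L_def by (intro cINF_greatest) (auto intro: pos_variation_mono[OF f])
  \<comment> \<open>For \<open>t < w < v\<close> the increment from \<open>w\<close> to
    \<open>v\<close> is at most \<open>pos_variation f v - L\<close>; letting \<open>w\<close>
    decrease to \<open>t\<close> uses right continuity of \<open>f\<close>. So the increment from
    \<open>t\<close> is paid for even without the jump \<open>L - pos_variation f t\<close>.\<close>
  have cross: "max (f v - f t) 0 \<le> pos_variation f v - L" if "t < v" for v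
  proof (rule tendsto_upperbound)
    show "((\<lambda>w. max (f v - f w) 0) \<longlongrightarrow> max (f v - f t) 0) (at_right t)"
      by (intro tendsto_intros rc)
    have "\<forall>\<^sub>F w in at_right t. w \<in> {t<..<v}"
      using that by (rule eventually_at_right_real)
    then show "\<forall>\<^sub>F w in at_right t. max (f v - f w) 0 \<le> pos_variation f v - L"
    proof eventually_elim
      case (elim w)
      then show ?case using pos_variation_increment[OF f, of w v] L_le[of w] by force
    qed
  qed simp
  \<comment> \<open>Removing the jump of the positive variation at \<open>t\<close> leaves an admissible function, so by
    minimality there is no jump.\<close>
  define h where "h u = (if u \<le> t then pos_variation f u else pos_variation f u - (L - pos_variation f t))" for u
  \<comment> \<open>Any time after \<open>t\<close> would do: there \<open>h\<close> is the
    variation minus the jump, so minimality forces the jump to be nonpositive.\<close>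
  have "pos_variation f (t + 1) \<le> h (t + 1)"
  proof (rule pos_variation_least[where h=h])
    fix u :: real
    show "0 \<le> h u"
      using pos_variation_nonneg[OF f, of u] pos_variation_nonneg[OF f, of t] L_le[of u]
      by (auto simp: h_def)
  next
    fix u v :: real assume uv: "u \<le> v"
    consider "v \<le> t" | "u \<le> t" "t < v" | "t < u" using uv by linarith
    then show "max (f v - f u) 0 \<le> h v - h u"
    proof cases
      case 2
      then show ?thesis
        using cross[of v] pos_variation_increment[OF f, of u t] by (auto simp: h_def)
    qed (use uv pos_variation_increment[OF f, of u v] in \<open>auto simp: h_def\<close>)
  qed
  then have L_eq: "L = pos_variation f t" using L_ge by (simp add: h_def)
  note P_less = pos_variation_mono[OF f, OF less_imp_le]
  show ?thesis
  proof (rule order_tendstoI)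
    fix a assume "a < pos_variation f t"
    then show "\<forall>\<^sub>F u in at_right t. a < pos_variation f u"
      unfolding eventually_at_right_field
      by (intro exI[of _ "t + 1"] conjI allI impI) (auto intro: less_le_trans[OF _ P_less])
  next
    fix a assume "pos_variation f t < a"
    then have "L < a" using L_eq by simp
    then obtain w where w: "t < w" "pos_variation f w < a"
      unfolding L_def by (subst (asm) cINF_less_iff[OF _ bdd]) auto
    then show "\<forall>\<^sub>F u in at_right t. pos_variation f u < a"
      unfolding eventually_at_right_field
      by (intro exI[of _ w] conjI allI impI) (auto intro: le_less_trans[OF P_less])
  qed
qed

section \<open>Rational partitions and measurability of the variation\<close>

text \<open>Rational partitions ending before an irrational \<open>t\<close> miss a jump of
  \<open>f\<close> at \<open>t\<close>, hence the infimum over rational \<open>q > t\<close>. One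
  inequality is right continuity of the variation, the other is its minimality applied to the
  infimum \<open>h\<close>.\<close>

lemma pos_variation_eq_INF_rational:
  assumes f: "control_path f"
  shows "pos_variation f t = (INF q\<in>\<rat> \<inter> {t<..}. pos_var_on \<rat> f q)"
proof -
  define h where "h u = (INF q\<in>\<rat> \<inter> {u<..}. pos_var_on \<rat> f q)" for u
  have ne: "\<rat> \<inter> {u<..} \<noteq> {}" for u :: real
    using Rats_dense_in_real[of u "u + 1"] by auto
  have bdd: "bdd_below (pos_var_on \<rat> f ` (\<rat> \<inter> {u<..}))" for u
    using pos_var_on_nonneg[OF f] by (intro bdd_belowI2[of _ 0]) auto
  have sub: "variation_sums (\<lambda>y. max y 0) f (\<rat> \<inter> {..q}) \<subseteq> variation_sums (\<lambda>y. max y 0) f (UNIV \<inter> {..q})" for q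
    by (rule variation_sums_mono) auto
  have le: "pos_var_on \<rat> f q \<le> pos_variation f q" if "q \<in> \<rat>" for q
    unfolding pos_variation_eq_pos_var_on pos_var_on_def
    by (rule cSup_subset_mono[OF variation_sums_nonempty[of q] bdd_above_pos_variation_sums_on[OF f] sub])
       (use that in auto)
  have "h t \<le> pos_variation f t"
  proof (rule tendsto_lowerbound[OF pos_variation_right_continuous[OF f, of t]])
    show "\<forall>\<^sub>F u in at_right t. h t \<le> pos_variation f u"
      unfolding eventually_at_right_field
    proof (intro exI[of _ "t + 1"] conjI allI impI)
      fix u assume "t < u"
      then obtain q where q: "q \<in> \<rat>" "t < q" "q < u" using Rats_dense_in_real by blast
      have "h t \<le> pos_var_on \<rat> f q"
        unfolding h_def using q by (intro cINF_lower bdd) auto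
      also have "\<dots> \<le> pos_variation f q" using le q by blast
      also have "\<dots> \<le> pos_variation f u" using q by (intro pos_variation_mono f) auto
      finally show "h t \<le> pos_variation f u" .
    qed simp
  qed simp
  moreover have "pos_variation f t \<le> h t"
  proof (rule pos_variation_least[where h=h])
    show "0 \<le> h u" for u
      unfolding h_def using pos_var_on_nonneg[OF f] by (intro cINF_greatest ne) auto
    fix u v :: real assume "u \<le> v"
    show "max (f v - f u) 0 \<le> h v - h u"
    proof (cases "u = v")
      case False
      with \<open>u \<le> v\<close> have "u < v" by simp
      have rc: "(f \<longlongrightarrow> f s) (at_right s)" for s
        using f by (simp add: control_path_def cadlag_def)
      \<comment> \<open>With \<open>h u\<close> on the left the bound is uniform in
        \<open>q\<close>, so taking the infimum over \<open>q > v\<close> turns it into a bound by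
        \<open>h v\<close>.\<close>
      have "max (f v - f u) 0 + h u \<le> pos_var_on \<rat> f q" if q: "q \<in> \<rat>" "v < q" for q
      proof -
        \<comment> \<open>\<open>f v - f u\<close> is a limit of increments of \<open>f\<close> between rationals \<open>x < y < q\<close>.\<close>
        have *: "max (f y - f x) 0 + h u \<le> pos_var_on \<rat> f q"
          if "x \<in> \<rat>" "y \<in> \<rat>" "u < x" "x < y" "y < q" for x y
        proof -
          have "h u \<le> pos_var_on \<rat> f x" unfolding h_def using that by (intro cINF_lower bdd) auto
          with pos_var_on_increment[OF f, of x \<rat> y] pos_var_on_increment[OF f, of y \<rat> q] that q(1)
          show ?thesis by auto
        qed
        have seq: "\<exists>x. (\<forall>n. x n \<in> \<rat> \<and> s < x n \<and> x n < e) \<and> (\<lambda>n::nat. f (x n)) \<longlonglongrightarrow> f s"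
          if "s < e" for s e :: real
        proof -
          have "\<exists>x\<in>\<rat>. s < x \<and> x < min e (s + 1 / real (Suc n))" for n
            using that by (intro Rats_dense_in_real) auto
          then obtain x where x: "\<And>n. x n \<in> \<rat> \<and> s < x n \<and> x n < min e (s + 1 / real (Suc n))"
            by metis
          have "x \<longlonglongrightarrow> s"
          proof (rule tendsto_sandwich[of "\<lambda>_. s" _ _ "\<lambda>n. s + 1 / real (Suc n)"])
            show "(\<lambda>n. s + 1 / real (Suc n)) \<longlonglongrightarrow> s"
              using tendsto_add[OF tendsto_const LIMSEQ_inverse_real_of_nat, of s]
              by (simp add: inverse_eq_divide)
          qed (use x in \<open>auto intro!: always_eventually simp: less_imp_le\<close>)
          then have "filterlim x (at_right s) sequentially"
            using x by (auto simp: filterlim_at intro!: always_eventually)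
          then have "(\<lambda>n. f (x n)) \<longlonglongrightarrow> f s" by (rule filterlim_compose[OF rc])
          then show ?thesis using x by auto
        qed
        obtain x where x: "\<And>n. x n \<in> \<rat> \<and> u < x n \<and> x n < v" "(\<lambda>n::nat. f (x n)) \<longlonglongrightarrow> f u"
          using seq[OF \<open>u < v\<close>] by blast
        obtain y where y: "\<And>n. y n \<in> \<rat> \<and> v < y n \<and> y n < q" "(\<lambda>n::nat. f (y n)) \<longlonglongrightarrow> f v"
          using seq[OF q(2)] by blast
        show ?thesis
        proof (rule LIMSEQ_le_const2)
          show "(\<lambda>n. max (f (y n) - f (x n)) 0 + h u) \<longlonglongrightarrow> max (f v - f u) 0 + h u"
            by (intro tendsto_intros x y)
          show "\<exists>N. \<forall>n\<ge>N. max (f (y n) - f (x n)) 0 + h u \<le> pos_var_on \<rat> f q"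
            using x(1) y(1) by (intro exI[of _ 0] allI impI *) (auto intro: less_trans)
        qed
      qed
      then have "max (f v - f u) 0 + h u \<le> h v"
        unfolding h_def[of v] by (intro cINF_greatest ne) auto
      then show ?thesis by linarith
    qed simp
  qed
  ultimately show ?thesis by (simp add: h_def)
qed

text \<open>The index set no longer depends on \<open>f\<close> and consists of lists of rationals,
  so it is countable and the supremum is measurable in \<open>\<omega>\<close>. A nonempty list of
  length \<open>n + 1\<close> encodes a partition with \<open>n\<close> steps.\<close>

lemma variation_sums_Rats_eq_image:
  "variation_sums (\<lambda>y. max y 0) f (\<rat> \<inter> {..q}) =
     (\<lambda>xs. \<Sum>i<length xs - 1. max (f (real_of_rat (xs ! Suc i)) - f (real_of_rat (xs ! i))) 0) `
     {xs :: rat list. xs \<noteq> [] \<and> (\<forall>i<length xs. real_of_rat (xs ! i) \<le> q) \<and>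
                 (\<forall>i<length xs - 1. xs ! i \<le> xs ! Suc i)}"
  (is "_ = ?s ` ?A")
proof (intro equalityI subsetI)
  fix r assume "r \<in> variation_sums (\<lambda>y. max y 0) f (\<rat> \<inter> {..q})"
  then obtain n x where r: "r = (\<Sum>i<n. max (f (x (Suc i)) - f (x i)) 0)"
    and x: "\<forall>i\<le>n. x i \<in> \<rat> \<inter> {..q}" "\<forall>i<n. x i \<le> x (Suc i)"
    by (auto simp: variation_sums_def)
  have "\<forall>i. \<exists>y. i \<le> n \<longrightarrow> x i = real_of_rat y"
    using x(1) by (auto elim!: Rats_cases)
  then obtain y where y: "\<And>i. i \<le> n \<Longrightarrow> x i = real_of_rat (y i)" by metis
  have nth: "map y [0..<Suc n] ! i = y i" if "i \<le> n" for i
    using that by (subst nth_map) (auto simp del: upt_Suc)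
  have "?s (map y [0..<Suc n]) = r"
    unfolding r by (simp add: nth y del: upt_Suc)
  moreover have "map y [0..<Suc n] \<in> ?A"
    using x by (auto simp: nth y less_Suc_eq_le of_rat_less_eq simp del: upt_Suc)
  ultimately show "r \<in> ?s ` ?A" by blast
next
  fix r assume "r \<in> ?s ` ?A"
  then obtain xs where xs: "xs \<in> ?A" "r = ?s xs" by blast
  then show "r \<in> variation_sums (\<lambda>y. max y 0) f (\<rat> \<inter> {..q})"
    unfolding variation_sums_def
    by (intro CollectI exI[of _ "length xs - 1"] exI[of _ "\<lambda>i. real_of_rat (xs ! i)"])
       (auto simp: of_rat_less_eq less_eq_Suc_le Suc_diff_le neq_Nil_conv)
qed

lemma measurable_pos_variation:
  assumes meas: "\<And>t. (\<lambda>\<omega>. X t \<omega>) \<in> borel_measurable M"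
    and path: "\<And>\<omega>. \<omega> \<in> space M \<Longrightarrow> control_path (\<lambda>t. X t \<omega>)"
  shows "(\<lambda>\<omega>. pos_variation (\<lambda>t. X t \<omega>) t) \<in> borel_measurable M"
proof -
  note [measurable] = meas
  have R: "(\<lambda>\<omega>. pos_var_on \<rat> (\<lambda>t. X t \<omega>) q) \<in> borel_measurable M" for q
    unfolding pos_var_on_def variation_sums_Rats_eq_image
  proof (rule borel_measurable_cSUP)
    fix \<omega> assume "\<omega> \<in> space M"
    from bdd_above_pos_variation_sums_on[OF path[OF this], of \<rat> q, unfolded variation_sums_Rats_eq_image]
    show "bdd_above ((\<lambda>xs. \<Sum>i<length xs - 1. max (X (real_of_rat (xs ! Suc i)) \<omega> - X (real_of_rat (xs ! i)) \<omega>) 0) `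
      {xs :: rat list. xs \<noteq> [] \<and> (\<forall>i<length xs. real_of_rat (xs ! i) \<le> q) \<and>
          (\<forall>i<length xs - 1. xs ! i \<le> xs ! Suc i)})" .
  qed measurable
  have "(\<lambda>\<omega>. INF q\<in>\<rat> \<inter> {t<..}. pos_var_on \<rat> (\<lambda>t. X t \<omega>) q) \<in> borel_measurable M"
    by (intro borel_measurable_cINF_real countable_Int1 countable_rat R)
  then show ?thesis
    by (subst measurable_cong[OF pos_variation_eq_INF_rational[OF path]])
qed

section \<open>Linear combinations of control paths\<close>

lemma control_path_combination:
  assumes f: "control_path f" and g: "control_path g"
  shows "control_path (\<lambda>t. a * f t + b * g t)"
  unfolding control_path_def
proof (intro conjI allI impI)
  show "a * f t + b * g t = 0" if "t < 0" for t
    using f g that by (simp add: control_path_def)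
  show "cadlag (\<lambda>t. a * f t + b * g t)"
    unfolding cadlag_def
  proof (intro allI conjI)
    fix t
    show "((\<lambda>t. a * f t + b * g t) \<longlongrightarrow> a * f t + b * g t) (at_right t)"
      using f g by (intro tendsto_intros) (auto simp: control_path_def cadlag_def)
    obtain k l where "(f \<longlongrightarrow> k) (at_left t)" "(g \<longlongrightarrow> l) (at_left t)"
      using f g unfolding control_path_def cadlag_def by meson
    then have "((\<lambda>t. a * f t + b * g t) \<longlongrightarrow> a * k + b * l) (at_left t)"
      by (intro tendsto_intros)
    then show "\<exists>l. ((\<lambda>t. a * f t + b * g t) \<longlongrightarrow> l) (at_left t)" ..
  qed
  fix T :: real assume "0 \<le> T"
  then obtain A B where A: "\<And>s. s \<in> variation_sums abs f {0..T} \<Longrightarrow> s \<le> A"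
    and B: "\<And>s. s \<in> variation_sums abs g {0..T} \<Longrightarrow> s \<le> B"
    using f g unfolding control_path_def bdd_above_def by meson
  show "bdd_above (variation_sums abs (\<lambda>t. a * f t + b * g t) {0..T})"
  proof (rule bdd_aboveI[of _ "\<bar>a\<bar> * A + \<bar>b\<bar> * B"])
    fix s assume "s \<in> variation_sums abs (\<lambda>t. a * f t + b * g t) {0..T}"
    then obtain n x where s: "s = (\<Sum>i<n. \<bar>a * f (x (Suc i)) + b * g (x (Suc i)) - (a * f (x i) + b * g (x i))\<bar>)"
      and x: "\<forall>i\<le>n. x i \<in> {0..T}" "\<forall>i<n. x i \<le> x (Suc i)"
      unfolding variation_sums_def by blast
    have step: "\<bar>a * p + b * q - (a * p' + b * q')\<bar> \<le> \<bar>a\<bar> * \<bar>p - p'\<bar> + \<bar>b\<bar> * \<bar>q - q'\<bar>" for p q p' q'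
    proof -
      have "a * p + b * q - (a * p' + b * q') = a * (p - p') + b * (q - q')"
        by (simp add: algebra_simps)
      then show ?thesis using abs_triangle_ineq[of "a * (p - p')" "b * (q - q')"] by (simp add: abs_mult)
    qed
    have "s \<le> (\<Sum>i<n. \<bar>a\<bar> * \<bar>f (x (Suc i)) - f (x i)\<bar> + \<bar>b\<bar> * \<bar>g (x (Suc i)) - g (x i)\<bar>)"
      unfolding s by (intro sum_mono step)
    also have "\<dots> = \<bar>a\<bar> * (\<Sum>i<n. \<bar>f (x (Suc i)) - f (x i)\<bar>) + \<bar>b\<bar> * (\<Sum>i<n. \<bar>g (x (Suc i)) - g (x i)\<bar>)"
      by (simp add: sum.distrib sum_distrib_left)
    also have "\<dots> \<le> \<bar>a\<bar> * A + \<bar>b\<bar> * B"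
      using x by (intro add_mono mult_left_mono A B) (auto simp: variation_sums_def)
    finally show "s \<le> \<bar>a\<bar> * A + \<bar>b\<bar> * B" .
  qed
qed

lemma control_path_uminus: "control_path f \<Longrightarrow> control_path (\<lambda>t. - f t)"
  using control_path_combination[of f f "-1" 0] by simp

lemma control_path_zero: "control_path (\<lambda>_. 0)"
proof -
  have "bdd_above (variation_sums abs (\<lambda>_. 0) S)" for S
    by (rule bdd_aboveI[of _ 0]) (auto simp: variation_sums_def)
  then show ?thesis
    unfolding control_path_def cadlag_def by auto
qed

section \<open>Discounted variation\<close>

definition discounted_variation :: "real \<Rightarrow> (real \<Rightarrow> real) \<Rightarrow> ennreal" where
  "discounted_variation \<rho> f = (\<integral>\<^sup>+t\<in>{0..}. ennreal (exp (- \<rho> * t)) \<partial>interval_measure (pos_variation f))"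

lemma nn_integral_exp_tail:
  assumes "\<rho> > 0"
  shows "(\<integral>\<^sup>+s. ennreal (\<rho> * exp (- \<rho> * s)) * indicator {t..} s \<partial>lborel) = ennreal (exp (- \<rho> * t))"
proof -
  have "((\<lambda>s. - exp (- \<rho> * s)) \<longlongrightarrow> - 0) at_top"
    using assms
    by (intro tendsto_minus filterlim_compose[OF exp_at_bot] filterlim_tendsto_neg_mult_at_bot[OF tendsto_const])
       (auto intro: filterlim_ident)
  then have "(\<integral>\<^sup>+s. ennreal (\<rho> * exp (- \<rho> * s)) * indicator {t..} s \<partial>lborel) = ennreal (0 - (- exp (- \<rho> * t)))"
    using assms by (intro nn_integral_FTC_atLeast) (auto intro!: derivative_eq_intros)
  then show ?thesis by simp
qed

text \<open>The closed left endpoint matters: the atom at 0 is the cost of a jump at time 0. The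
  mass is \<open>P s\<close> minus the left limit of \<open>P\<close> at 0, which is 0. Half-open
  intervals are what \<open>interval_measure\<close> evaluates directly, so the null set
  \<open>{-1<..<0}\<close> is added to reach \<open>{-1<..s}\<close>.\<close>

lemma emeasure_interval_measure_Icc_0:
  fixes P :: "real \<Rightarrow> real"
  assumes mono: "\<And>x y. x \<le> y \<Longrightarrow> P x \<le> P y" and rc: "\<And>a. continuous (at_right a) P"
    and zero: "\<And>t. t < 0 \<Longrightarrow> P t = 0"
  shows "emeasure (interval_measure P) {0..s} = ennreal (if 0 \<le> s then P s else 0)"
proof (cases "0 \<le> s")
  case True
  \<comment> \<open>Both endpoints are negative, where \<open>P\<close> is 0; these intervals
    exhaust the negative half-line.\<close>
  have "{- real (Suc n) <.. - (1 / real (Suc n))} \<in> null_sets (interval_measure P)" for n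
    by (auto simp: null_sets_def emeasure_interval_measure_Ioc_eq[OF mono rc] zero)
  then have N: "(\<Union>n. {- real (Suc n) <.. - (1 / real (Suc n))}) \<in> null_sets (interval_measure P)"
    by (intro null_sets_UN)
  have "{-1<..<0} \<subseteq> (\<Union>n. {- real (Suc n) <.. - (1 / real (Suc n))})"
  proof
    fix x :: real assume x: "x \<in> {-1<..<0}"
    then obtain n where "inverse (real (Suc n)) < - x"
      using reals_Archimedean[of "- x"] by auto
    then have "x \<in> {- real (Suc n) <.. - (1 / real (Suc n))}" using x by (auto simp: inverse_eq_divide)
    then show "x \<in> (\<Union>n. {- real (Suc n) <.. - (1 / real (Suc n))})" by blast
  qed
  then have "{-1<..<0} \<in> null_sets (interval_measure P)"
    by (rule null_sets_subset[OF N, rotated]) simp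
  then have "emeasure (interval_measure P) ({0..s} \<union> {-1<..<0}) = emeasure (interval_measure P) {0..s}"
    by (intro emeasure_Un_null_set) auto
  moreover have "{0..s} \<union> {-1<..<0} = {-1<..s}" using True by auto
  moreover have "emeasure (interval_measure P) {-1<..s} = ennreal (P s - P (- 1))"
    using True by (intro emeasure_interval_measure_Ioc mono rc) auto
  ultimately show ?thesis using True zero by simp
qed simp

text \<open>Tonelli, after writing \<open>exp (- \<rho> * t)\<close> as the integral of \<open>\<rho> * exp (- \<rho> * s)\<close> over \<open>s \<ge> t\<close>.
  The right-hand side is visibly monotone and sublinear in the positive variation, and measurable
  in parameters, none of which is clear for the Stieltjes integral.\<close>

lemma discounted_variation_eq:
  assumes f: "control_path f" and "\<rho> > 0"
  shows "discounted_variation \<rho> f =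
    (\<integral>\<^sup>+s\<in>{0..}. ennreal (\<rho> * exp (- \<rho> * s)) * ennreal (pos_variation f s) \<partial>lborel)"
proof -
  let ?P = "pos_variation f"
  let ?N = "interval_measure ?P"
  have mono: "x \<le> y \<Longrightarrow> ?P x \<le> ?P y" for x y by (rule pos_variation_mono[OF f])
  have rc: "continuous (at_right a) ?P" for a
    by (simp add: continuous_within pos_variation_right_continuous[OF f])
  interpret N: sigma_finite_measure ?N
    by (rule sigma_finite_interval_measure[OF mono rc])
  interpret pair_sigma_finite lborel ?N ..
  \<comment> \<open>One kernel, two readings: integrating out \<open>s\<close> gives the discount
    factor at \<open>t\<close>, integrating out \<open>t\<close> gives the mass of
    \<open>{0..s}\<close> times the exponential density.\<close>
  let ?k = "\<lambda>s t. if 0 \<le> t \<and> t \<le> s then ennreal (\<rho> * exp (- \<rho> * s)) else 0"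
  have "discounted_variation \<rho> f = (\<integral>\<^sup>+t. (\<integral>\<^sup>+s. ?k s t \<partial>lborel) \<partial>?N)"
    unfolding discounted_variation_def
  proof (rule nn_integral_cong)
    fix t
    have "(\<integral>\<^sup>+s. ?k s t \<partial>lborel) =
        (\<integral>\<^sup>+s. (ennreal (\<rho> * exp (- \<rho> * s)) * indicator {t..} s) * indicator {0..} t \<partial>lborel)"
      by (intro nn_integral_cong) (auto split: split_indicator)
    also have "\<dots> = ennreal (exp (- \<rho> * t)) * indicator {0..} t"
      by (subst nn_integral_multc) (simp_all only: nn_integral_exp_tail[OF \<open>\<rho> > 0\<close>], measurable)
    finally show "ennreal (exp (- \<rho> * t)) * indicator {0..} t = (\<integral>\<^sup>+s. ?k s t \<partial>lborel)" ..
  qed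
  also have "\<dots> = (\<integral>\<^sup>+s. (\<integral>\<^sup>+t. ?k s t \<partial>?N) \<partial>lborel)"
    by (rule Fubini') measurable
  also have "\<dots> = (\<integral>\<^sup>+s\<in>{0..}. ennreal (\<rho> * exp (- \<rho> * s)) * ennreal (?P s) \<partial>lborel)"
  proof (rule nn_integral_cong)
    fix s
    have "(\<integral>\<^sup>+t. ?k s t \<partial>?N) = (\<integral>\<^sup>+t. ennreal (\<rho> * exp (- \<rho> * s)) * indicator {0..s} t \<partial>?N)"
      by (intro nn_integral_cong) (auto split: split_indicator)
    also have "\<dots> = ennreal (\<rho> * exp (- \<rho> * s)) * emeasure ?N {0..s}"
      by (subst nn_integral_cmult) auto
    also have "emeasure ?N {0..s} = ennreal (?P s) * indicator {0..} s"
      by (subst emeasure_interval_measure_Icc_0[OF mono rc pos_variation_neg_time[OF f]])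
         (auto split: split_indicator)
    finally show "(\<integral>\<^sup>+t. ?k s t \<partial>?N) = ennreal (\<rho> * exp (- \<rho> * s)) * ennreal (?P s) * indicator {0..} s"
      by (simp add: mult.assoc)
  qed
  finally show ?thesis .
qed

lemma discounted_variation_zero: "\<rho> > 0 \<Longrightarrow> discounted_variation \<rho> (\<lambda>_. 0) = 0"
proof -
  assume "\<rho> > 0"
  \<comment> \<open>An upper bound suffices, because \<open>ennreal\<close> sends nonpositive
    numbers to 0.\<close>
  have "pos_variation (\<lambda>_. 0) t \<le> 0" for t
    by (rule pos_variation_least[where h="\<lambda>_. 0"]) auto
  then show ?thesis
    by (simp add: discounted_variation_eq[OF control_path_zero \<open>\<rho> > 0\<close>] ennreal_neg)
qed

text \<open>Monotonicity comes first, and additivity is applied only to the measurable majorant. The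
  same inequality serves the discounted variation (integral in \<open>s\<close>), the running cost
  (in \<open>t\<close>) and the expectation (in \<open>\<omega>\<close>).\<close>

lemma nn_integral_combination_le:
  assumes "f \<in> borel_measurable M" "g \<in> borel_measurable M"
    and "\<And>x. x \<in> space M \<Longrightarrow> h x \<le> a * f x + b * g x"
  shows "integral\<^sup>N M h \<le> a * integral\<^sup>N M f + b * integral\<^sup>N M g"
proof -
  have "integral\<^sup>N M h \<le> (\<integral>\<^sup>+x. a * f x + b * g x \<partial>M)"
    by (intro nn_integral_mono assms)
  also have "\<dots> = a * integral\<^sup>N M f + b * integral\<^sup>N M g"
    using assms by (simp add: nn_integral_add nn_integral_cmult)
  finally show ?thesis .
qed

lemma discounted_variation_combination:
  assumes f: "control_path f" and g: "control_path g" and ab: "0 \<le> a" "0 \<le> b" and "\<rho> > 0"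
  shows "discounted_variation \<rho> (\<lambda>t. a * f t + b * g t)
    \<le> ennreal a * discounted_variation \<rho> f + ennreal b * discounted_variation \<rho> g"
proof -
  have [measurable]: "pos_variation f \<in> borel_measurable borel" "pos_variation g \<in> borel_measurable borel"
    using f g by (auto intro!: borel_measurable_mono monoI pos_variation_mono)
  show ?thesis
    unfolding discounted_variation_eq[OF control_path_combination[OF f g] \<open>\<rho> > 0\<close>]
      discounted_variation_eq[OF f \<open>\<rho> > 0\<close>] discounted_variation_eq[OF g \<open>\<rho> > 0\<close>]
  proof (rule nn_integral_combination_le)
    fix s :: real
    have "ennreal (pos_variation (\<lambda>t. a * f t + b * g t) s)
        \<le> ennreal (a * pos_variation f s + b * pos_variation g s)"
      by (intro ennreal_leI pos_variation_combination f g ab)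
    also have "\<dots> = ennreal a * ennreal (pos_variation f s) + ennreal b * ennreal (pos_variation g s)"
      using ab pos_variation_nonneg[OF f] pos_variation_nonneg[OF g]
      by (simp add: ennreal_plus ennreal_mult)
    finally have "ennreal (\<rho> * exp (- \<rho> * s)) * ennreal (pos_variation (\<lambda>t. a * f t + b * g t) s) * indicator {0..} s
      \<le> ennreal (\<rho> * exp (- \<rho> * s)) * (ennreal a * ennreal (pos_variation f s) + ennreal b * ennreal (pos_variation g s)) * indicator {0..} s"
      by (intro mult_right_mono mult_left_mono) auto
    then show "ennreal (\<rho> * exp (- \<rho> * s)) * ennreal (pos_variation (\<lambda>t. a * f t + b * g t) s) * indicator {0..} s
      \<le> ennreal a * (ennreal (\<rho> * exp (- \<rho> * s)) * ennreal (pos_variation f s) * indicator {0..} s)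
       + ennreal b * (ennreal (\<rho> * exp (- \<rho> * s)) * ennreal (pos_variation g s) * indicator {0..} s)"
      by (simp only: distrib_left distrib_right mult_ac)
  qed measurable
qed

section \<open>Measurability of costs\<close>

text \<open>Evaluating at grid times to the right of \<open>t\<close> selects among countably many
  fixed-time variables, hence is jointly measurable; refining the grid recovers the process by right
  continuity.\<close>

lemma right_continuous_process_measurable:
  fixes X :: "real \<Rightarrow> 'a \<Rightarrow> real"
  assumes meas: "\<And>t. X t \<in> borel_measurable M"
    and rc: "\<And>\<omega> t. \<omega> \<in> space M \<Longrightarrow> ((\<lambda>s. X s \<omega>) \<longlongrightarrow> X t \<omega>) (at_right t)"
  shows "(\<lambda>p. X (snd p) (fst p)) \<in> borel_measurable (M \<Otimes>\<^sub>M borel)"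
proof -
  \<comment> \<open>The next point of the grid of mesh \<open>1 / real (Suc n)\<close>. Floor plus
    one, unlike the ceiling, lies strictly above \<open>t\<close> even at grid points, as
    convergence along \<open>at_right t\<close> requires.\<close>
  define r where "r n t = (real_of_int \<lfloor>real (Suc n) * t\<rfloor> + 1) / real (Suc n)" for n and t :: real
  show ?thesis
  proof (rule borel_measurable_LIMSEQ_real)
    fix n
    have "(\<lambda>p. X ((real_of_int \<lfloor>real (Suc n) * snd p\<rfloor> + 1) / real (Suc n)) (fst p))
        \<in> borel_measurable (M \<Otimes>\<^sub>M borel)"
    proof (rule measurable_compose_countable[where f="\<lambda>k p. X ((real_of_int k + 1) / real (Suc n)) (fst p)"])
      show "(\<lambda>p. X ((real_of_int k + 1) / real (Suc n)) (fst p)) \<in> borel_measurable (M \<Otimes>\<^sub>M borel)" for k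
        by (rule measurable_compose[OF measurable_fst meas])
    qed measurable
    then show "(\<lambda>p. X (r n (snd p)) (fst p)) \<in> borel_measurable (M \<Otimes>\<^sub>M borel)"
      by (simp add: r_def)
  next
    fix p assume p: "p \<in> space (M \<Otimes>\<^sub>M (borel :: real measure))"
    define t where "t = snd p"
    have b: "t < r n t" "r n t \<le> t + 1 / real (Suc n)" for n
    proof -
      have "real (Suc n) * t < real_of_int \<lfloor>real (Suc n) * t\<rfloor> + 1" by linarith
      then show "t < r n t" by (simp add: r_def field_simps)
      have "real_of_int \<lfloor>real (Suc n) * t\<rfloor> \<le> real (Suc n) * t" by linarith
      then have "real_of_int \<lfloor>real (Suc n) * t\<rfloor> / real (Suc n) \<le> t"
        by (simp add: divide_le_eq mult.commute)
      then show "r n t \<le> t + 1 / real (Suc n)" by (simp add: r_def add_divide_distrib)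
    qed
    have "(\<lambda>n. r n t) \<longlonglongrightarrow> t"
    proof (rule tendsto_sandwich[of "\<lambda>_. t" _ _ "\<lambda>n. t + 1 / real (Suc n)"])
      show "(\<lambda>n. t + 1 / real (Suc n)) \<longlonglongrightarrow> t"
        using tendsto_add[OF tendsto_const LIMSEQ_inverse_real_of_nat, of t]
        by (simp add: inverse_eq_divide)
    qed (use b in \<open>auto intro!: always_eventually simp: less_imp_le\<close>)
    then have "filterlim (\<lambda>n. r n t) (at_right t) sequentially"
      using b(1) by (auto simp: filterlim_at less_imp_neq[THEN not_sym] intro!: always_eventually)
    then show "(\<lambda>n. X (r n (snd p)) (fst p)) \<longlonglongrightarrow> X (snd p) (fst p)"
      using p filterlim_compose[OF rc[of "fst p" t]] by (simp add: t_def space_pair_measure mem_Times_iff)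
  qed
qed

definition demand_process :: "'a measure \<Rightarrow> real set \<Rightarrow> (real \<Rightarrow> 'a \<Rightarrow> real) \<Rightarrow> bool" where
  "demand_process M J X \<longleftrightarrow> (\<forall>t\<ge>0. X t \<in> borel_measurable M) \<and>
     (\<forall>\<omega>\<in>space M. continuous_on {0..} (\<lambda>t. X t \<omega>) \<and> (\<forall>t\<ge>0. X t \<omega> \<in> J))"

definition running_cost ::
    "(real \<Rightarrow> real \<Rightarrow> real) \<Rightarrow> real \<Rightarrow> real \<Rightarrow> (real \<Rightarrow> real) \<Rightarrow> (real \<Rightarrow> real) \<Rightarrow> ennreal" where
  "running_cost g \<rho> c f x = (\<integral>\<^sup>+t\<in>{0..}. ennreal (exp (- \<rho> * t) * g (c + f t) (x t)) \<partial>lborel)"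

text \<open>Forgets the filtration, since expectations see only measurability in \<open>M\<close>;
  all real times are covered, as a negative time carries the value 0.\<close>

definition measurable_control :: "'a measure \<Rightarrow> (real \<Rightarrow> 'a \<Rightarrow> real) \<Rightarrow> bool" where
  "measurable_control M I \<longleftrightarrow> (\<forall>t. I t \<in> borel_measurable M) \<and> (\<forall>\<omega>\<in>space M. control_path (\<lambda>t. I t \<omega>))"

lemma adapted_measurable:
  assumes F: "usual_filtration M F" and "adapted F X" "0 \<le> t"
  shows "X t \<in> borel_measurable M"
proof -
  have "\<forall>t\<ge>0. space (F t) = space M \<and> sets (F t) \<subseteq> sets M"
    using F unfolding usual_filtration_def by (rule conjunct1)
  moreover have "X t \<in> borel_measurable (F t)"
    using assms by (simp add: adapted_def)
  ultimately show ?thesis using \<open>0 \<le> t\<close> unfolding measurable_def by auto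
qed

lemma controls_measurable_control:
  assumes F: "usual_filtration M F" and I: "I \<in> controls M F"
  shows "measurable_control M I"
  unfolding measurable_control_def
proof (intro conjI allI ballI)
  fix t show "I t \<in> borel_measurable M"
  proof (cases "0 \<le> t")
    case True
    then show ?thesis using adapted_measurable[OF F] I by (auto simp: controls_def)
  next
    case False
    then show ?thesis using I by (subst measurable_cong[where g="\<lambda>_. 0"]) (auto simp: controls_def)
  qed
qed (use I in \<open>auto simp: controls_def control_path_def\<close>)

lemma controls_combination:
  assumes I: "I \<in> controls M F" and J: "J \<in> controls M F"
  shows "(\<lambda>t \<omega>. a * I t \<omega> + b * J t \<omega>) \<in> controls M F"
proof -
  have "control_path (\<lambda>t. a * I t \<omega> + b * J t \<omega>)" if "\<omega> \<in> space M" for \<omega>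
    using I J that by (intro control_path_combination) (auto simp: controls_def control_path_def)
  moreover have "adapted F (\<lambda>t \<omega>. a * I t \<omega> + b * J t \<omega>)"
    using I J by (auto simp: controls_def adapted_def
      intro!: borel_measurable_add borel_measurable_times)
  ultimately show ?thesis by (simp add: controls_def control_path_def)
qed

lemma controls_zero: "(\<lambda>t \<omega>. 0) \<in> controls M F"
  using control_path_zero by (auto simp: controls_def control_path_def adapted_def)

lemma measurable_control_uminus:
  "measurable_control M I \<Longrightarrow> measurable_control M (\<lambda>t \<omega>. - I t \<omega>)"
  by (auto simp: measurable_control_def control_path_uminus)

lemma measurable_discounted_variation:
  assumes I: "measurable_control M I" and "\<rho> > 0"
  shows "(\<lambda>\<omega>. discounted_variation \<rho> (\<lambda>t. I t \<omega>)) \<in> borel_measurable M"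
proof -
  have path: "control_path (\<lambda>t. I t \<omega>)" if "\<omega> \<in> space M" for \<omega>
    using I that by (simp add: measurable_control_def)
  have "(\<lambda>p. pos_variation (\<lambda>t. I t (fst p)) (snd p)) \<in> borel_measurable (M \<Otimes>\<^sub>M borel)"
    using I by (intro right_continuous_process_measurable measurable_pos_variation
      pos_variation_right_continuous) (auto simp: measurable_control_def)
  then have [measurable]: "(\<lambda>p. pos_variation (\<lambda>t. I t (fst p)) (snd p)) \<in> borel_measurable (M \<Otimes>\<^sub>M lborel)"
    by (simp cong: measurable_cong_sets)
  have "(\<lambda>\<omega>. \<integral>\<^sup>+s\<in>{0..}. ennreal (\<rho> * exp (- \<rho> * s)) * ennreal (pos_variation (\<lambda>t. I t \<omega>) s) \<partial>lborel)
      \<in> borel_measurable M"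
    by (rule lborel.borel_measurable_nn_integral) (simp add: split_beta')
  then show ?thesis
    by (subst measurable_cong[OF discounted_variation_eq[OF path \<open>\<rho> > 0\<close>]])
qed

section \<open>Measurability and convexity of the running cost\<close>

text \<open>Demand is constrained only at times \<open>t >= 0\<close>. Freezing it at its initial
  value for negative times gives paths continuous on the whole line.\<close>

lemma demand_process_measurable:
  assumes "demand_process M J X"
  shows "(\<lambda>p. X (max (snd p) 0) (fst p)) \<in> borel_measurable (M \<Otimes>\<^sub>M borel)"
proof (rule right_continuous_process_measurable)
  show "X (max t 0) \<in> borel_measurable M" for t
    using assms by (simp add: demand_process_def)
  fix \<omega> t assume "\<omega> \<in> space M"
  then have "continuous_on {0..} (\<lambda>t. X t \<omega>)" using assms by (simp add: demand_process_def)
  then have "continuous_on UNIV (\<lambda>s. X (max s 0) \<omega>)"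
    by (rule continuous_on_compose2) (auto intro!: continuous_intros)
  then have "isCont (\<lambda>s. X (max s 0) \<omega>) t" by (simp add: continuous_on_eq_continuous_at)
  then show "((\<lambda>s. X (max s 0) \<omega>) \<longlongrightarrow> X (max t 0) \<omega>) (at_right t)"
    by (simp add: isCont_def filterlim_at_split)
qed

lemma running_cost_integrand_measurable:
  assumes I: "measurable_control M I" and X: "demand_process M J X"
    and g: "continuous_on (UNIV \<times> J) (\<lambda>(c, d). g c d)"
  shows "(\<lambda>p. g (c + I (snd p) (fst p)) (X (max (snd p) 0) (fst p))) \<in> borel_measurable (M \<Otimes>\<^sub>M lborel)"
proof -
  have [measurable]: "(\<lambda>p. X (max (snd p) 0) (fst p)) \<in> borel_measurable (M \<Otimes>\<^sub>M borel)"
    by (rule demand_process_measurable[OF X])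
  have [measurable]: "(\<lambda>p. I (snd p) (fst p)) \<in> borel_measurable (M \<Otimes>\<^sub>M borel)"
    using I by (intro right_continuous_process_measurable)
      (auto simp: measurable_control_def control_path_def cadlag_def)
  have "(\<lambda>p. (c + I (snd p) (fst p), X (max (snd p) 0) (fst p)))
      \<in> (M \<Otimes>\<^sub>M borel) \<rightarrow>\<^sub>M restrict_space borel (UNIV \<times> J)"
    using X by (intro measurable_restrict_space2 borel_measurable_Pair)
      (auto simp: demand_process_def space_pair_measure)
  from measurable_compose[OF this borel_measurable_continuous_on_restrict[OF g]]
  show ?thesis by (simp cong: measurable_cong_sets)
qed

text \<open>The indicator hides the freezing, so the jointly measurable integrand may replace the
  original one.\<close>

lemma running_cost_eq:
  "running_cost g \<rho> c f x =
    (\<integral>\<^sup>+t. ennreal (exp (- \<rho> * t) * g (c + f t) (x (max t 0))) * indicator {0..} t \<partial>lborel)"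
  unfolding running_cost_def by (intro nn_integral_cong) (auto split: split_indicator)

lemma measurable_running_cost:
  assumes "measurable_control M I" "demand_process M J X"
    "continuous_on (UNIV \<times> J) (\<lambda>(c, d). g c d)"
  shows "(\<lambda>\<omega>. running_cost g \<rho> c (\<lambda>t. I t \<omega>) (\<lambda>t. X t \<omega>)) \<in> borel_measurable M"
proof -
  note [measurable] = running_cost_integrand_measurable[OF assms]
  show ?thesis
    unfolding running_cost_eq by (rule lborel.borel_measurable_nn_integral) (simp add: split_beta')
qed

lemma running_cost_combination:
  assumes I: "measurable_control M I" and I': "measurable_control M I'" and X: "demand_process M J X"
    and g: "continuous_on (UNIV \<times> J) (\<lambda>(c, d). g c d)"
    and nonneg: "\<And>c d. d \<in> J \<Longrightarrow> 0 \<le> g c d"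
    and convex: "\<And>d. d \<in> J \<Longrightarrow> convex_on UNIV (\<lambda>c. g c d)"
    and ab: "0 \<le> a" "0 \<le> b" "a + b = 1" and \<omega>: "\<omega> \<in> space M"
  shows "running_cost g \<rho> (a * c + b * c') (\<lambda>t. a * I t \<omega> + b * I' t \<omega>) (\<lambda>t. X t \<omega>)
    \<le> ennreal a * running_cost g \<rho> c (\<lambda>t. I t \<omega>) (\<lambda>t. X t \<omega>)
      + ennreal b * running_cost g \<rho> c' (\<lambda>t. I' t \<omega>) (\<lambda>t. X t \<omega>)"
  unfolding running_cost_eq
proof (rule nn_integral_combination_le)
  have slice: "(\<lambda>t. g (c + I t \<omega>) (X (max t 0) \<omega>)) \<in> borel_measurable borel"
    if "measurable_control M I" for I c
    using measurable_compose[OF measurable_Pair1' running_cost_integrand_measurable[OF that X g], OF \<omega>]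
    by simp
  note [measurable] = slice[OF I] slice[OF I']
  show "(\<lambda>t. ennreal (exp (- \<rho> * t) * g (c + I t \<omega>) (X (max t 0) \<omega>)) * indicator {0..} t) \<in> borel_measurable lborel"
    "(\<lambda>t. ennreal (exp (- \<rho> * t) * g (c' + I' t \<omega>) (X (max t 0) \<omega>)) * indicator {0..} t) \<in> borel_measurable lborel"
    by measurable
  fix t
  define x where "x = X (max t 0) \<omega>"
  have x: "x \<in> J" using X \<omega> by (simp add: demand_process_def x_def)
  \<comment> \<open>Capacity is jointly affine in the initial level and the control, so at each time
    convexity of \<open>g\<close> applies to the two capacities.\<close>
  have "g (a * c + b * c' + (a * I t \<omega> + b * I' t \<omega>)) x = g (a * (c + I t \<omega>) + b * (c' + I' t \<omega>)) x"
    by (simp add: algebra_simps)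
  also have "\<dots> \<le> a * g (c + I t \<omega>) x + b * g (c' + I' t \<omega>) x"
    using convex[OF x] ab unfolding convex_on_def by auto
  finally have "exp (- \<rho> * t) * g (a * c + b * c' + (a * I t \<omega> + b * I' t \<omega>)) x
      \<le> a * (exp (- \<rho> * t) * g (c + I t \<omega>) x) + b * (exp (- \<rho> * t) * g (c' + I' t \<omega>) x)"
    by (subst mult.left_commute, subst (2) mult.left_commute, subst distrib_left[symmetric])
       (rule mult_left_mono, simp_all)
  then have "ennreal (exp (- \<rho> * t) * g (a * c + b * c' + (a * I t \<omega> + b * I' t \<omega>)) x)
      \<le> ennreal a * ennreal (exp (- \<rho> * t) * g (c + I t \<omega>) x) + ennreal b * ennreal (exp (- \<rho> * t) * g (c' + I' t \<omega>) x)"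
    using ab nonneg[OF x]
    by (subst (1 2) ennreal_mult[symmetric]; simp add: ennreal_plus[symmetric] ennreal_leI del: ennreal_plus)
  then show "ennreal (exp (- \<rho> * t) * g (a * c + b * c' + (a * I t \<omega> + b * I' t \<omega>)) (X (max t 0) \<omega>)) * indicator {0..} t
      \<le> ennreal a * (ennreal (exp (- \<rho> * t) * g (c + I t \<omega>) (X (max t 0) \<omega>)) * indicator {0..} t)
       + ennreal b * (ennreal (exp (- \<rho> * t) * g (c' + I' t \<omega>) (X (max t 0) \<omega>)) * indicator {0..} t)"
    unfolding x_def by (auto split: split_indicator)
qed

section \<open>Convexity and growth of the value function\<close>

lemma total_cost_eq:
  "total_cost M D g \<rho> qp qm c d I = enn2ereal (\<integral>\<^sup>+\<omega>. running_cost g \<rho> c (\<lambda>t. I t \<omega>) (\<lambda>t. D d t \<omega>)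
     + ennreal qp * discounted_variation \<rho> (\<lambda>t. I t \<omega>)
     + ennreal qm * discounted_variation \<rho> (\<lambda>t. - I t \<omega>) \<partial>M)"
proof -
  have "neg_variation f = pos_variation (\<lambda>s. - f s)" for f
    by (rule ext) (rule neg_variation_eq_pos_variation)
  then show ?thesis
    by (simp add: total_cost_def running_cost_def discounted_variation_def)
qed

lemma total_cost_combination:
  assumes F: "usual_filtration M F" and I: "I \<in> controls M F" and I': "I' \<in> controls M F"
    and X: "demand_process M J (D d)"
    and g: "continuous_on (UNIV \<times> J) (\<lambda>(c, d). g c d)"
    and nonneg: "\<And>c d. d \<in> J \<Longrightarrow> 0 \<le> g c d"
    and convex: "\<And>d. d \<in> J \<Longrightarrow> convex_on UNIV (\<lambda>c. g c d)"
    and ab: "0 \<le> a" "0 \<le> b" "a + b = 1" and "\<rho> > 0"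
  shows "total_cost M D g \<rho> qp qm (a * c + b * c') d (\<lambda>t \<omega>. a * I t \<omega> + b * I' t \<omega>)
    \<le> ereal a * total_cost M D g \<rho> qp qm c d I + ereal b * total_cost M D g \<rho> qp qm c' d I'"
proof -
  let ?cost = "\<lambda>c I \<omega>. running_cost g \<rho> c (\<lambda>t. I t \<omega>) (\<lambda>t. D d t \<omega>)
     + ennreal qp * discounted_variation \<rho> (\<lambda>t. I t \<omega>)
     + ennreal qm * discounted_variation \<rho> (\<lambda>t. - I t \<omega>)"
  note mI = controls_measurable_control[OF F I] and mI' = controls_measurable_control[OF F I']
  have meas: "?cost c I \<in> borel_measurable M" if "measurable_control M I" for c I
    using measurable_running_cost[OF that X g] measurable_discounted_variation[OF that \<open>\<rho> > 0\<close>]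
      measurable_discounted_variation[OF measurable_control_uminus[OF that] \<open>\<rho> > 0\<close>]
    by (intro borel_measurable_add borel_measurable_times measurable_const) auto
  have "(\<integral>\<^sup>+\<omega>. ?cost (a * c + b * c') (\<lambda>t \<omega>. a * I t \<omega> + b * I' t \<omega>) \<omega> \<partial>M)
      \<le> ennreal a * (\<integral>\<^sup>+\<omega>. ?cost c I \<omega> \<partial>M) + ennreal b * (\<integral>\<^sup>+\<omega>. ?cost c' I' \<omega> \<partial>M)"
  proof (rule nn_integral_combination_le[OF meas[OF mI] meas[OF mI']])
    fix \<omega> assume \<omega>: "\<omega> \<in> space M"
    then have path: "control_path (\<lambda>t. I t \<omega>)" "control_path (\<lambda>t. I' t \<omega>)"
      using mI mI' by (auto simp: measurable_control_def)
    \<comment> \<open>Written this way, the downward cost of the combination is again the discounted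
      variation of a combination with nonnegative weights, now of the negated paths.\<close>
    have neg: "(\<lambda>t. - (a * I t \<omega> + b * I' t \<omega>)) = (\<lambda>t. a * (- I t \<omega>) + b * (- I' t \<omega>))" by auto
    have "?cost (a * c + b * c') (\<lambda>t \<omega>. a * I t \<omega> + b * I' t \<omega>) \<omega>
      \<le> (ennreal a * running_cost g \<rho> c (\<lambda>t. I t \<omega>) (\<lambda>t. D d t \<omega>)
          + ennreal b * running_cost g \<rho> c' (\<lambda>t. I' t \<omega>) (\<lambda>t. D d t \<omega>))
        + ennreal qp * (ennreal a * discounted_variation \<rho> (\<lambda>t. I t \<omega>)
          + ennreal b * discounted_variation \<rho> (\<lambda>t. I' t \<omega>))
        + ennreal qm * (ennreal a * discounted_variation \<rho> (\<lambda>t. - I t \<omega>)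
          + ennreal b * discounted_variation \<rho> (\<lambda>t. - I' t \<omega>))"
      unfolding neg
      by (intro add_mono mult_left_mono discounted_variation_combination control_path_uminus path
          running_cost_combination[OF mI mI' X g nonneg convex ab \<omega>] ab \<open>\<rho> > 0\<close>) auto
    also have "\<dots> = ennreal a * ?cost c I \<omega> + ennreal b * ?cost c' I' \<omega>"
      by (simp only: distrib_left add_ac mult_ac)
    finally show "?cost (a * c + b * c') (\<lambda>t \<omega>. a * I t \<omega> + b * I' t \<omega>) \<omega>
      \<le> ennreal a * ?cost c I \<omega> + ennreal b * ?cost c' I' \<omega>" .
  qed
  then have "enn2ereal (\<integral>\<^sup>+\<omega>. ?cost (a * c + b * c') (\<lambda>t \<omega>. a * I t \<omega> + b * I' t \<omega>) \<omega> \<partial>M)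
      \<le> enn2ereal (ennreal a * (\<integral>\<^sup>+\<omega>. ?cost c I \<omega> \<partial>M) + ennreal b * (\<integral>\<^sup>+\<omega>. ?cost c' I' \<omega> \<partial>M))"
    by (simp only: less_eq_ennreal.rep_eq)
  then show ?thesis
    unfolding total_cost_eq using ab by (simp add: plus_ennreal.rep_eq times_ennreal.rep_eq)
qed

lemma value_function_nonneg: "0 \<le> value_function M F D g \<rho> qp qm c d"
  unfolding value_function_def by (rule INF_greatest) (simp add: total_cost_def)

lemma value_function_le_uncontrolled_cost:
  assumes "\<rho> > 0"
  shows "value_function M F D g \<rho> qp qm c d \<le> uncontrolled_cost M D g \<rho> c d"
proof -
  have "value_function M F D g \<rho> qp qm c d \<le> total_cost M D g \<rho> qp qm c d (\<lambda>t \<omega>. 0)"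
    unfolding value_function_def by (intro INF_lower controls_zero)
  also have "\<dots> = uncontrolled_cost M D g \<rho> c d"
    unfolding total_cost_eq uncontrolled_cost_def
    by (simp add: running_cost_def discounted_variation_zero[OF assms])
  finally show ?thesis .
qed

text \<open>The infimum need not be attained, so near-optimal controls for the two initial levels
  are combined; the combination competes at the combined level. Finiteness lets
  \<open>real_of_ereal\<close> represent the value faithfully.\<close>

lemma value_function_convex:
  assumes F: "usual_filtration M F" and X: "demand_process M J (D d)"
    and g: "continuous_on (UNIV \<times> J) (\<lambda>(c, d). g c d)"
    and nonneg: "\<And>c d. d \<in> J \<Longrightarrow> 0 \<le> g c d"
    and convex: "\<And>d. d \<in> J \<Longrightarrow> convex_on UNIV (\<lambda>c. g c d)"
    and "\<rho> > 0" and finite: "\<And>c. value_function M F D g \<rho> qp qm c d < \<infinity>"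
  shows "convex_on UNIV (\<lambda>c. real_of_ereal (value_function M F D g \<rho> qp qm c d))"
proof -
  define w where "w c = real_of_ereal (value_function M F D g \<rho> qp qm c d)" for c
  have w: "value_function M F D g \<rho> qp qm c d = ereal (w c)" for c
    using finite[of c] value_function_nonneg[of M F D g \<rho> qp qm c d]
    unfolding w_def by (subst ereal_real) auto
  have approx: "\<exists>I\<in>controls M F. total_cost M D g \<rho> qp qm c d I \<le> ereal (w c + e)" if "e > 0" for c e
  proof -
    have "value_function M F D g \<rho> qp qm c d < ereal (w c + e)" using that by (simp add: w)
    then show ?thesis unfolding value_function_def INF_less_iff by (auto intro: less_imp_le)
  qed
  have "convex_on UNIV w"
  proof (rule convex_onI)
    fix s x y :: real assume s: "0 < s" "s < 1"
    have "w ((1 - s) * x + s * y) \<le> (1 - s) * w x + s * w y + e" if e: "e > 0" for e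
    proof -
      obtain I I' where I: "I \<in> controls M F" "total_cost M D g \<rho> qp qm x d I \<le> ereal (w x + e)"
        and I': "I' \<in> controls M F" "total_cost M D g \<rho> qp qm y d I' \<le> ereal (w y + e)"
        using approx[OF e] by meson
      have "ereal (w ((1 - s) * x + s * y))
          \<le> total_cost M D g \<rho> qp qm ((1 - s) * x + s * y) d (\<lambda>t \<omega>. (1 - s) * I t \<omega> + s * I' t \<omega>)"
        unfolding w[symmetric] value_function_def
        by (intro INF_lower controls_combination I(1) I'(1))
      also have "\<dots> \<le> ereal (1 - s) * total_cost M D g \<rho> qp qm x d I + ereal s * total_cost M D g \<rho> qp qm y d I'"
        using s by (intro total_cost_combination[where D=D and d=d, OF F I(1) I'(1) X g nonneg convex]) (auto simp: \<open>\<rho> > 0\<close>)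
      also have "\<dots> \<le> ereal (1 - s) * ereal (w x + e) + ereal s * ereal (w y + e)"
        using s by (intro add_mono ereal_mult_left_mono I I') auto
      finally show ?thesis by (simp add: algebra_simps)
    qed
    then show "w ((1 - s) *\<^sub>R x + s *\<^sub>R y) \<le> (1 - s) * w x + s * w y"
      \<comment> \<open>The weights add up to 1, so two errors \<open>e\<close> combine to exactly
        \<open>e\<close>, which is arbitrary.\<close>
      unfolding real_scaleR_def by (rule field_le_epsilon)
  qed simp
  then show ?thesis by (simp add: w_def[abs_def])
qed

section \<open>Growth of the uncontrolled cost\<close>

lemma nn_integral_two_exponentials:
  fixes A B :: real
  assumes "0 \<le> A" "0 \<le> B" "0 < r" "0 < s"
  shows "(\<integral>\<^sup>+t. ennreal (A * exp (- r * t) + B * exp (- s * t)) * indicator {0..} t \<partial>lborel)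
    = ennreal (A / r + B / s)"
proof -
  have lim: "((\<lambda>t. exp (- k * t)) \<longlongrightarrow> 0) at_top" if "k > 0" for k :: real
    using that
    by (intro filterlim_compose[OF exp_at_bot] filterlim_tendsto_neg_mult_at_bot[OF tendsto_const])
       (auto intro: filterlim_ident)
  have "((\<lambda>t. - A / r * exp (- r * t) + - B / s * exp (- s * t)) \<longlongrightarrow> - A / r * 0 + - B / s * 0) at_top"
    using assms by (intro tendsto_intros lim)
  then have "(\<integral>\<^sup>+t. ennreal (A * exp (- r * t) + B * exp (- s * t)) * indicator {0..} t \<partial>lborel)
      = ennreal (0 - (- A / r * exp (- r * 0) + - B / s * exp (- s * 0)))"
    using assms by (intro nn_integral_FTC_atLeast) (auto intro!: derivative_eq_intros)
  then show ?thesis by (simp add: add.commute)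
qed

lemma abs_pow_nonneg: "0 \<le> abs_pow x \<nu>"
  by (simp add: abs_pow_def)

lemma abs_pow_measurable [measurable]: "(\<lambda>x. abs_pow x \<nu>) \<in> borel_measurable borel"
  unfolding abs_pow_def by measurable

text \<open>The constant part of the growth bound is discounted at rate \<open>\<rho>\<close>. The
  moment part grows at rate \<open>k\<close> under discounting at rate \<open>\<rho>\<close>, which
  leaves the net rate \<open>\<rho> - k\<close>; positivity of the two rates makes the time
  integrals finite.\<close>

lemma uncontrolled_cost_bound:
  assumes "prob_space M" and X: "demand_process M J (D d)"
    and growth: "\<And>x. x \<in> J \<Longrightarrow> g c x \<le> A + B * abs_pow x \<nu>" and AB: "0 \<le> A" "0 \<le> B" "0 \<le> K"
    and moments: "\<And>t. 0 \<le> t \<Longrightarrow> (\<integral>\<^sup>+\<omega>. ennreal (abs_pow (D d t \<omega>) \<nu>) \<partial>M) \<le> ennreal (K * exp (k * t))"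
    and \<rho>: "0 < \<rho>" "k < \<rho>"
  shows "uncontrolled_cost M D g \<rho> c d \<le> ereal (A / \<rho> + B * K / (\<rho> - k))"
proof -
  interpret prob_space M by fact
  interpret pair_sigma_finite M lborel ..
  let ?b = "\<lambda>\<omega> t. (ennreal (exp (- \<rho> * t) * A) + ennreal (exp (- \<rho> * t) * B) * ennreal (abs_pow (D d (max t 0) \<omega>) \<nu>)) * indicator {0..} t"
  have [measurable]: "(\<lambda>p. D d (max (snd p) 0) (fst p)) \<in> borel_measurable (M \<Otimes>\<^sub>M lborel)"
    using demand_process_measurable[OF X] by (simp cong: measurable_cong_sets)
  have D_meas: "D d (max t 0) \<in> borel_measurable M" for t
    using X by (simp add: demand_process_def)
  have "(\<integral>\<^sup>+\<omega>. (\<integral>\<^sup>+t\<in>{0..}. ennreal (exp (- \<rho> * t) * g c (D d t \<omega>)) \<partial>lborel) \<partial>M)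
      \<le> (\<integral>\<^sup>+\<omega>. (\<integral>\<^sup>+t. ?b \<omega> t \<partial>lborel) \<partial>M)"
  proof (intro nn_integral_mono)
    fix \<omega> t assume \<omega>: "\<omega> \<in> space M"
    show "ennreal (exp (- \<rho> * t) * g c (D d t \<omega>)) * indicator {0..} t \<le> ?b \<omega> t"
    proof (cases "0 \<le> t")
      case True
      then have "D d t \<omega> \<in> J" using X \<omega> by (simp add: demand_process_def)
      then have "exp (- \<rho> * t) * g c (D d t \<omega>) \<le> exp (- \<rho> * t) * (A + B * abs_pow (D d t \<omega>) \<nu>)"
        by (intro mult_left_mono growth) auto
      also have "\<dots> = exp (- \<rho> * t) * A + (exp (- \<rho> * t) * B) * abs_pow (D d t \<omega>) \<nu>"
        by (simp add: algebra_simps)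
      finally have "ennreal (exp (- \<rho> * t) * g c (D d t \<omega>))
          \<le> ennreal (exp (- \<rho> * t) * A + (exp (- \<rho> * t) * B) * abs_pow (D d t \<omega>) \<nu>)"
        by (rule ennreal_leI)
      also have "\<dots> = ennreal (exp (- \<rho> * t) * A) + ennreal (exp (- \<rho> * t) * B) * ennreal (abs_pow (D d t \<omega>) \<nu>)"
        using AB abs_pow_nonneg[of "D d t \<omega>" \<nu>] by (subst ennreal_mult[symmetric]) (auto simp: ennreal_plus)
      finally show ?thesis using True by simp
    qed simp
  qed
  also have "\<dots> = (\<integral>\<^sup>+t. (\<integral>\<^sup>+\<omega>. ?b \<omega> t \<partial>M) \<partial>lborel)"
    by (rule Fubini'[symmetric]) (simp add: split_beta')
  also have "\<dots> \<le> (\<integral>\<^sup>+t. ennreal (A * exp (- \<rho> * t) + (B * K) * exp (- (\<rho> - k) * t)) * indicator {0..} t \<partial>lborel)"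
  proof (intro nn_integral_mono)
    fix t :: real
    show "(\<integral>\<^sup>+\<omega>. ?b \<omega> t \<partial>M) \<le> ennreal (A * exp (- \<rho> * t) + (B * K) * exp (- (\<rho> - k) * t)) * indicator {0..} t"
    proof (cases "0 \<le> t")
      case True
      have [measurable]: "D d t \<in> borel_measurable M" using D_meas[of t] True by simp
      have "(\<integral>\<^sup>+\<omega>. ?b \<omega> t \<partial>M) = ennreal (exp (- \<rho> * t) * A)
          + ennreal (exp (- \<rho> * t) * B) * (\<integral>\<^sup>+\<omega>. ennreal (abs_pow (D d t \<omega>) \<nu>) \<partial>M)"
        using True by (simp add: nn_integral_add nn_integral_cmult emeasure_space_1)
      also have "\<dots> \<le> ennreal (exp (- \<rho> * t) * A) + ennreal (exp (- \<rho> * t) * B) * ennreal (K * exp (k * t))"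
        using True by (intro add_left_mono mult_left_mono moments) auto
      also have "\<dots> = ennreal (exp (- \<rho> * t) * A + exp (- \<rho> * t) * B * (K * exp (k * t)))"
        using AB by (subst ennreal_mult[symmetric]) (auto simp: ennreal_plus)
      also have "exp (- \<rho> * t) * A + exp (- \<rho> * t) * B * (K * exp (k * t))
          = A * exp (- \<rho> * t) + (B * K) * exp (- (\<rho> - k) * t)"
      proof -
        have "exp (- (\<rho> - k) * t) = exp (- \<rho> * t) * exp (k * t)"
          by (simp add: exp_add[symmetric] algebra_simps)
        then show ?thesis by (simp add: algebra_simps)
      qed
      finally show ?thesis using True by simp
    qed simp
  qed
  also have "\<dots> = ennreal (A / \<rho> + B * K / (\<rho> - k))"
    using AB \<rho> by (intro nn_integral_two_exponentials) auto
  finally have "uncontrolled_cost M D g \<rho> c d \<le> enn2ereal (ennreal (A / \<rho> + B * K / (\<rho> - k)))"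
    unfolding uncontrolled_cost_def by (simp only: less_eq_ennreal.rep_eq)
  also have "\<dots> = ereal (A / \<rho> + B * K / (\<rho> - k))"
    using AB \<rho> by (intro enn2ereal_ennreal) auto
  finally show ?thesis .
qed

lemma locally_bounded_combination:
  assumes f: "locally_bounded f" and g: "locally_bounded g"
  shows "locally_bounded (\<lambda>x. a * f x + b * g x)"
  unfolding locally_bounded_def
proof
  fix x
  obtain U V where U: "open U" "x \<in> U" "bounded (f ` U)" and V: "open V" "x \<in> V" "bounded (g ` V)"
    using f g unfolding locally_bounded_def by meson
  obtain A B where A: "\<And>y. y \<in> U \<Longrightarrow> \<bar>f y\<bar> \<le> A" and B: "\<And>y. y \<in> V \<Longrightarrow> \<bar>g y\<bar> \<le> B"
    using U(3) V(3) unfolding bounded_iff by fastforce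
  have "\<bar>a * f y + b * g y\<bar> \<le> \<bar>a\<bar> * A + \<bar>b\<bar> * B" if "y \<in> U \<inter> V" for y
  proof -
    have "\<bar>a * f y + b * g y\<bar> \<le> \<bar>a\<bar> * \<bar>f y\<bar> + \<bar>b\<bar> * \<bar>g y\<bar>"
      using abs_triangle_ineq[of "a * f y" "b * g y"] by (simp add: abs_mult)
    also have "\<dots> \<le> \<bar>a\<bar> * A + \<bar>b\<bar> * B"
      using that by (intro add_mono mult_left_mono A B) auto
    finally show ?thesis .
  qed
  then have "bounded ((\<lambda>x. a * f x + b * g x) ` (U \<inter> V))"
    unfolding bounded_iff by auto
  then show "\<exists>U. open U \<and> x \<in> U \<and> bounded ((\<lambda>x. a * f x + b * g x) ` U)"
    using U V by (intro exI[of _ "U \<inter> V"]) auto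
qed

lemma sde_solution_demand_process:
  assumes "usual_filtration M F" "sde_solution M F W J \<mu> \<sigma> x X"
  shows "demand_process M J X"
  using assms adapted_measurable[OF assms(1)] by (auto simp: sde_solution_def demand_process_def)

theorem proposition3p1:
  fixes M :: "'a measure" and F :: "real \<Rightarrow> 'a measure" and W :: "real \<Rightarrow> 'a \<Rightarrow> real"
    and dmin dmax :: ereal and \<O> :: "real set"
    and \<mu> \<sigma> :: "real \<Rightarrow> real" and D :: "real \<Rightarrow> real \<Rightarrow> 'a \<Rightarrow> real"
    and g gc :: "real \<Rightarrow> real \<Rightarrow> real" and \<gamma>0 \<eta>0 :: "real \<Rightarrow> real"
    and \<nu> K0 K1 \<rho> qp qm :: real
  defines "\<O> \<equiv> open_interval dmin dmax"
  assumes prob: "prob_space M"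
    and filtration: "usual_filtration M F"
    and brownian: "brownian_motion M F W"
    and interval: "dmin < dmax"
    and cont_coeffs: "continuous_on \<O> \<mu>" "continuous_on \<O> \<sigma>"
    and linear_growth: "\<exists>L. \<forall>x\<in>\<O>. \<bar>\<mu> x\<bar> + \<bar>\<sigma> x\<bar> \<le> L * (1 + \<bar>x\<bar>)"
    and demand: "\<forall>d\<in>\<O>. unique_sde_solution M F W \<O> \<mu> \<sigma> d (D d)"
    and demand_cont: "\<forall>d\<in>\<O>. \<forall>dn. (\<forall>n. dn n \<in> \<O>) \<longrightarrow> dn \<longlonglongrightarrow> d \<longrightarrow>
           (\<forall>t\<ge>0. AE \<omega> in M. (\<lambda>n. D (dn n) t \<omega>) \<longlonglongrightarrow> D d t \<omega>)"
    and demand_mono: "\<forall>d\<in>\<O>. \<forall>d'\<in>\<O>. d \<le> d' \<longrightarrow> (\<forall>t\<ge>0. AE \<omega> in M. D d t \<omega> \<le> D d' t \<omega>)"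
    and regular: "regular_diffusion M \<O> D"
    and natural_bds: "natural_lower_boundary \<O> \<mu> \<sigma>" "natural_upper_boundary \<O> \<mu> \<sigma>"
    and g_nonneg: "\<forall>c. \<forall>d\<in>\<O>. 0 \<le> g c d"
    and g_cont: "continuous_on (UNIV \<times> \<O>) (\<lambda>(c, d). g c d)"
    and g_deriv: "\<forall>c. \<forall>d\<in>\<O>. ((\<lambda>x. g x d) has_real_derivative gc c d) (at c)"
    and g_convex: "\<forall>d\<in>\<O>. convex_on UNIV (\<lambda>c. g c d)"
    and gc_cont: "continuous_on (UNIV \<times> \<O>) (\<lambda>(c, d). gc c d)"
    and gc_antimono: "\<forall>c. antimono_on \<O> (gc c)"
    and nu: "0 \<le> \<nu>"
    and growth_coeffs: "\<forall>c. 0 < \<gamma>0 c" "\<forall>c. 0 < \<eta>0 c" "locally_bounded \<gamma>0" "locally_bounded \<eta>0"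
    and g_growth: "\<forall>c. \<forall>d\<in>\<O>. \<bar>g c d\<bar> + \<bar>gc c d\<bar> \<le> \<gamma>0 c + \<eta>0 c * abs_pow d \<nu>"
    and K0: "0 \<le> K0"
    and moments: "\<forall>t\<ge>0. \<forall>d\<in>\<O>. (\<integral>\<^sup>+\<omega>. ennreal (abs_pow (D d t \<omega>) \<nu>) \<partial>M)
           \<le> ennreal (K0 * (1 + abs_pow d \<nu>) * exp (K1 * t))"
    and rho: "\<rho> > max K1 0"
    and costs: "0 < qp" "0 < qm"
  shows "(\<forall>d\<in>\<O>. convex_on UNIV (\<lambda>c. real_of_ereal (value_function M F D g \<rho> qp qm c d))) \<and>
    (\<exists>\<gamma>1 \<eta>1. locally_bounded \<gamma>1 \<and> locally_bounded \<eta>1 \<and>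
       (\<forall>c. \<forall>d\<in>\<O>.
          0 \<le> value_function M F D g \<rho> qp qm c d \<and>
          value_function M F D g \<rho> qp qm c d \<le> uncontrolled_cost M D g \<rho> c d \<and>
          uncontrolled_cost M D g \<rho> c d \<le> ereal (\<gamma>1 c + \<eta>1 c * abs_pow d \<nu>)))"
proof -
  have \<rho>: "\<rho> > 0" "K1 < \<rho>" using rho by auto
  have X: "demand_process M \<O> (D d)" if "d \<in> \<O>" for d
    using demand that sde_solution_demand_process[OF filtration] unfolding unique_sde_solution_def by blast
  \<comment> \<open>The bound with \<open>K = K0 * (1 + abs_pow d \<nu>)\<close>, sorted by powers
    of the demand: the 1 goes into \<open>\<gamma>1\<close>, the power into \<open>\<eta>1\<close>.
    The zero term in \<open>\<eta>1\<close> only gives it the shape of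
    \<open>locally_bounded_combination\<close>.\<close>
  define \<gamma>1 where "\<gamma>1 c = 1 / \<rho> * \<gamma>0 c + K0 / (\<rho> - K1) * \<eta>0 c" for c
  define \<eta>1 where "\<eta>1 c = 0 * \<gamma>0 c + K0 / (\<rho> - K1) * \<eta>0 c" for c
  have "locally_bounded \<gamma>1" "locally_bounded \<eta>1"
    unfolding \<gamma>1_def[abs_def] \<eta>1_def[abs_def] by (intro locally_bounded_combination growth_coeffs)+
  moreover have bound: "uncontrolled_cost M D g \<rho> c d \<le> ereal (\<gamma>1 c + \<eta>1 c * abs_pow d \<nu>)"
    if d: "d \<in> \<O>" for c d
  proof -
    have "uncontrolled_cost M D g \<rho> c d
        \<le> ereal (\<gamma>0 c / \<rho> + \<eta>0 c * (K0 * (1 + abs_pow d \<nu>)) / (\<rho> - K1))"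
    proof (rule uncontrolled_cost_bound[where D=D and J=\<O> and \<nu>=\<nu>, OF prob X[OF d]])
      show "g c x \<le> \<gamma>0 c + \<eta>0 c * abs_pow x \<nu>" if "x \<in> \<O>" for x
      proof -
        have "\<bar>g c x\<bar> + \<bar>gc c x\<bar> \<le> \<gamma>0 c + \<eta>0 c * abs_pow x \<nu>" using g_growth that by blast
        then show ?thesis by linarith
      qed
      show "(\<integral>\<^sup>+\<omega>. ennreal (abs_pow (D d t \<omega>) \<nu>) \<partial>M) \<le> ennreal (K0 * (1 + abs_pow d \<nu>) * exp (K1 * t))"
        if "0 \<le> t" for t using moments that d by blast
      show "0 \<le> \<gamma>0 c" "0 \<le> \<eta>0 c" using growth_coeffs(1,2) by (simp_all add: less_imp_le)
      show "0 \<le> K0 * (1 + abs_pow d \<nu>)" using K0 abs_pow_nonneg[of d \<nu>] by simp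
    qed (use \<rho> in auto)
    also have "\<gamma>0 c / \<rho> + \<eta>0 c * (K0 * (1 + abs_pow d \<nu>)) / (\<rho> - K1) = \<gamma>1 c + \<eta>1 c * abs_pow d \<nu>"
      by (simp add: \<gamma>1_def \<eta>1_def add_divide_distrib algebra_simps)
    finally show ?thesis .
  qed
  moreover have "convex_on UNIV (\<lambda>c. real_of_ereal (value_function M F D g \<rho> qp qm c d))"
    if d: "d \<in> \<O>" for d
  proof (rule value_function_convex[where D=D and J=\<O>, OF filtration X[OF d] g_cont])
    show "value_function M F D g \<rho> qp qm c d < \<infinity>" for c
    proof -
      have "value_function M F D g \<rho> qp qm c d \<le> ereal (\<gamma>1 c + \<eta>1 c * abs_pow d \<nu>)"
        using value_function_le_uncontrolled_cost[OF \<rho>(1)] bound[OF d] by (rule order_trans)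
      then show ?thesis by (rule le_less_trans) simp
    qed
  qed (use g_nonneg g_convex \<rho> in auto)
  ultimately show ?thesis
    by (intro conjI exI[of _ \<gamma>1] exI[of _ \<eta>1] allI ballI value_function_nonneg
        value_function_le_uncontrolled_cost \<rho>(1))
qed

end
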